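(* Let $u$ be a convex function on $\overline\Omega$ ($D^2u\ge0$), let $t\in[0,1]$, and fix a point of $\partial\Omega$. With the boundary quantities $L_t,r_\nu,z,\alpha_t,\beta_t$ and $\delta_t=L_t-F(A_t[u])$ at this point, defined in the context, $$\delta_t=\arctan\frac{\alpha_t}{r_\nu-\beta_t},\qquad \alpha_t>0,\qquad r_\nu-\beta_t\ge0 .$$ If moreover $|Du|\le P$ and $|z|\le Z$ at this point, then $$r_\nu=\beta_t+\alpha_t\cot\delta_t,\qquad 1\le\alpha_t\le C(P,Z),\qquad |\beta_t|\le C(P,Z),$$ where $C(P,Z)$ depends only on $P$ and $Z$.
   Context: $\Omega\subset\mathbb R^n$, $n\ge2$, is a bounded smooth domain, $\nu$ is the inward unit normal of $\partial\Omega$, and $u$ is $C^2$ up to the boundary. For $t\in[0,1]$: $w_t(p)=\sqrt{1+t^2|p|^2}$, $B_t(p)=(I+t^2p\otimes p)^{-1/2}$, $A_t[u]=\frac1{w_t(Du)}B_t(Du)D^2u\,B_t(Du)$, and $F(M)=\sum_{i=1}^n\arctan\lambda_i(M)$. At a boundary point decompose $Du=q+s\nu$ with $q$ tangential ($q=D_T\varphi$, $\varphi=u|_{\partial\Omega}$) and $s=u_\nu$. In the orthogonal splitting $T_x\partial\Omega\oplus\mathbb R\nu$ write $$D^2u=\begin{pmatrix} M & z \\ z^T & r_\nu \end{pmatrix},\qquad C_t:=w_t(Du)(I+t^2Du\otimes Du)=\begin{pmatrix} C_{t,T} & c_t \\ c_t^T & c_{t,0} \end{pmatrix},$$ so $M$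 is the tangential block, $z(\xi)=D^2u(\xi,\nu)$ for tangential $\xi$, $r_\nu=u_{\nu\nu}$, $C_{t,T}=w_t(Du)(I_T+t^2q\otimes q)$, $c_t=w_t(Du)t^2sq$, $c_{t,0}=w_t(Du)(1+t^2s^2)$. Set $$L_t=\frac\pi2+\sum_{\alpha=1}^{n-1}\arctan\lambda_\alpha\bigl(C_{t,T}^{-1/2}MC_{t,T}^{-1/2}\bigr),$$ $$D_t=C_{t,T}+\sqrt{-1}\,M,\quad e_t=c_t+\sqrt{-1}\,z,\quad S_t=e_t^TD_t^{-1}e_t,$$ $$\alpha_t=c_{t,0}-\operatorname{Re}S_t,\qquad \beta_t=\operatorname{Im}S_t,\qquad \delta_t=L_t-F(A_t[u]),$$ where $e_t^T$ is the complex bilinear transpose (not Hermitian). Convention: if $r_\nu-\beta_t=0$ the quotient $\alpha_t/(r_\nu-\beta_t)$ is interpreted as $+\infty$ and $\arctan(+\infty)=\pi/2$. *)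

theory Defs
  imports
    "HOL-Analysis.Derivative"
    "HOL-Analysis.Abstract_Euclidean_Space"
    "HOL-Computational_Algebra.Polynomial"
    "Jordan_Normal_Form.Char_Poly"
    "Jordan_Normal_Form.Gauss_Jordan_Elimination"
begin

(* Points of R^n are points of the topological space Euclidean_space n, i.e. functions
   nat => real vanishing at all indices >= n.  This keeps n a number, so that a constant can be
   independent of n.  Gradients and Hessians are vectors and matrices of Jordan_Normal_Form,
   where \<bullet> is the bilinear (not the Hermitian) dot product. *)

section \<open>Differentiable functions and smooth domains\<close>

definition pd :: "nat \<Rightarrow> ((nat \<Rightarrow> real) \<Rightarrow> real) \<Rightarrow> (nat \<Rightarrow> real) \<Rightarrow> real" where
  "pd i f x = deriv (\<lambda>h. f (x(i := h))) (x i)"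

(* Intended for sets U that are open in R^n. *)
primrec Ck_on :: "nat \<Rightarrow> nat \<Rightarrow> (nat \<Rightarrow> real) set \<Rightarrow> ((nat \<Rightarrow> real) \<Rightarrow> real) \<Rightarrow> bool" where
  "Ck_on n 0 U f \<longleftrightarrow> continuous_map (subtopology (Euclidean_space n) U) euclideanreal f"
| "Ck_on n (Suc k) U f \<longleftrightarrow>
     continuous_map (subtopology (Euclidean_space n) U) euclideanreal f \<and>
     (\<forall>i<n. (\<forall>x\<in>U. (\<lambda>h. f (x(i := h))) differentiable (at (x i))) \<and> Ck_on n k U (pd i f))"

definition smooth_on :: "nat \<Rightarrow> (nat \<Rightarrow> real) set \<Rightarrow> ((nat \<Rightarrow> real) \<Rightarrow> real) \<Rightarrow> bool" where
  "smooth_on n U f \<longleftrightarrow> (\<forall>k. Ck_on n k U f)"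

definition grad :: "nat \<Rightarrow> ((nat \<Rightarrow> real) \<Rightarrow> real) \<Rightarrow> (nat \<Rightarrow> real) \<Rightarrow> real vec" where
  "grad n f x = Matrix.vec n (\<lambda>i. pd i f x)"

definition vnorm :: "real vec \<Rightarrow> real" where
  "vnorm v = sqrt (v \<bullet> v)"

definition local_defining_function ::
  "nat \<Rightarrow> (nat \<Rightarrow> real) set \<Rightarrow> (nat \<Rightarrow> real) \<Rightarrow> (nat \<Rightarrow> real) set \<Rightarrow> ((nat \<Rightarrow> real) \<Rightarrow> real) \<Rightarrow> bool" where
  "local_defining_function n \<Omega> x U \<rho> \<longleftrightarrow>
     openin (Euclidean_space n) U \<and> x \<in> U \<and> smooth_on n U \<rho> \<and>
     grad n \<rho> x \<noteq> 0\<^sub>v n \<and> \<Omega> \<inter> U = {y \<in> U. 0 < \<rho> y}"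

definition bounded_smooth_domain :: "nat \<Rightarrow> (nat \<Rightarrow> real) set \<Rightarrow> bool" where
  "bounded_smooth_domain n \<Omega> \<longleftrightarrow>
     openin (Euclidean_space n) \<Omega> \<and> connectedin (Euclidean_space n) \<Omega> \<and> \<Omega> \<noteq> {} \<and>
     (\<exists>R. \<forall>x\<in>\<Omega>. sqrt (\<Sum>i<n. (x i)\<^sup>2) \<le> R) \<and>
     (\<forall>x \<in> Euclidean_space n frontier_of \<Omega>. \<exists>U \<rho>. local_defining_function n \<Omega> x U \<rho>)"

(* A defining function is positive inside, so its gradient points into the domain. *)
definition inward_unit_normal :: "nat \<Rightarrow> (nat \<Rightarrow> real) set \<Rightarrow> (nat \<Rightarrow> real) \<Rightarrow> real vec \<Rightarrow> bool" where
  "inward_unit_normal n \<Omega> x \<nu> \<longleftrightarrow>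
     (\<exists>U \<rho>. local_defining_function n \<Omega> x U \<rho> \<and>
        \<nu> = (1 / vnorm (grad n \<rho> x)) \<cdot>\<^sub>v grad n \<rho> x)"

definition extends_continuously ::
  "nat \<Rightarrow> (nat \<Rightarrow> real) set \<Rightarrow> ((nat \<Rightarrow> real) \<Rightarrow> real) \<Rightarrow> bool" where
  "extends_continuously n \<Omega> f \<longleftrightarrow>
     (\<exists>g. continuous_map (subtopology (Euclidean_space n) (Euclidean_space n closure_of \<Omega>))
            euclideanreal g \<and> (\<forall>x\<in>\<Omega>. g x = f x))"

definition C2_up_to_boundary :: "nat \<Rightarrow> (nat \<Rightarrow> real) set \<Rightarrow> ((nat \<Rightarrow> real) \<Rightarrow> real) \<Rightarrow> bool" where
  "C2_up_to_boundary n \<Omega> u \<longleftrightarrow>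
     Ck_on n 2 \<Omega> u \<and>
     continuous_map (subtopology (Euclidean_space n) (Euclidean_space n closure_of \<Omega>))
       euclideanreal u \<and>
     (\<forall>i<n. extends_continuously n \<Omega> (pd i u)) \<and>
     (\<forall>i<n. \<forall>j<n. extends_continuously n \<Omega> (pd i (pd j u)))"

(* Values on the closure of the domain of the continuous extensions of Du and D^2 u. *)
definition Du :: "nat \<Rightarrow> (nat \<Rightarrow> real) set \<Rightarrow> ((nat \<Rightarrow> real) \<Rightarrow> real) \<Rightarrow> (nat \<Rightarrow> real) \<Rightarrow> real vec" where
  "Du n \<Omega> u x = Matrix.vec n (\<lambda>i. Lim (atin_within (Euclidean_space n) x \<Omega>) (pd i u))"

definition D2u :: "nat \<Rightarrow> (nat \<Rightarrow> real) set \<Rightarrow> ((nat \<Rightarrow> real) \<Rightarrow> real) \<Rightarrow> (nat \<Rightarrow> real) \<Rightarrow> real mat" where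
  "D2u n \<Omega> u x =
     Matrix.mat n n (\<lambda>(i, j). Lim (atin_within (Euclidean_space n) x \<Omega>) (pd i (pd j u)))"

section \<open>Matrix functions\<close>

(* Symmetry is not part of this predicate; a Hessian of a C^2 function has it anyway. *)
definition nonneg_form :: "real mat \<Rightarrow> bool" where
  "nonneg_form A \<longleftrightarrow> (\<forall>v \<in> carrier_vec (dim_row A). 0 \<le> v \<bullet> (A *\<^sub>v v))"

definition sym_posdef :: "real mat \<Rightarrow> bool" where
  "sym_posdef A \<longleftrightarrow> square_mat A \<and> A\<^sup>T = A \<and>
     (\<forall>v \<in> carrier_vec (dim_row A). v \<noteq> 0\<^sub>v (dim_row A) \<longrightarrow> 0 < v \<bullet> (A *\<^sub>v v))"

(* The matrix A^(-1/2), for symmetric positive definite A; there is exactly one such B. *)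
definition inv_sqrt_mat :: "real mat \<Rightarrow> real mat" where
  "inv_sqrt_mat A =
     (SOME B. B \<in> carrier_mat (dim_row A) (dim_row A) \<and> sym_posdef B \<and>
        (B * B) * A = 1\<^sub>m (dim_row A))"

(* F(M), the sum of the arctangents of the eigenvalues counted with multiplicity; for a real symmetric matrix all of them are real,
   hence roots of the real characteristic polynomial. *)
definition phase :: "real mat \<Rightarrow> real" where
  "phase M = (\<Sum>\<mu>\<in>#proots (char_poly M). arctan \<mu>)"

definition outer_prod :: "real vec \<Rightarrow> real vec \<Rightarrow> real mat" where
  "outer_prod p q = Matrix.mat (dim_vec p) (dim_vec q) (\<lambda>(i, j). p $ i * q $ j)"

definition w_fun :: "real \<Rightarrow> real vec \<Rightarrow> real" where
  "w_fun t p = sqrt (1 + t\<^sup>2 * (vnorm p)\<^sup>2)"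

definition metric_mat :: "real \<Rightarrow> real vec \<Rightarrow> real mat" where
  "metric_mat t p = 1\<^sub>m (dim_vec p) + t\<^sup>2 \<cdot>\<^sub>m outer_prod p p"

definition B_mat :: "real \<Rightarrow> real vec \<Rightarrow> real mat" where
  "B_mat t p = inv_sqrt_mat (metric_mat t p)"

(* A_t[u], as a function of t, p = Du and H = D^2 u. *)
definition A_mat :: "real \<Rightarrow> real vec \<Rightarrow> real mat \<Rightarrow> real mat" where
  "A_mat t p H = (1 / w_fun t p) \<cdot>\<^sub>m (B_mat t p * H * B_mat t p)"

definition C_mat :: "real \<Rightarrow> real vec \<Rightarrow> real mat" where
  "C_mat t p = w_fun t p \<cdot>\<^sub>m metric_mat t p"

section \<open>The splitting of the ambient space at a boundary point\<close>

(* The columns of T are an orthonormal basis of the tangent space, the orthogonal complement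
   of \<nu>.  Operators on and vectors in the tangent space are written in this basis. *)
definition tangent_frame :: "nat \<Rightarrow> real vec \<Rightarrow> real mat \<Rightarrow> bool" where
  "tangent_frame n \<nu> T \<longleftrightarrow>
     T \<in> carrier_mat n (n - 1) \<and> T\<^sup>T * T = 1\<^sub>m (n - 1) \<and> T\<^sup>T *\<^sub>v \<nu> = 0\<^sub>v (n - 1)"

definition blk_TT :: "real mat \<Rightarrow> real mat \<Rightarrow> real mat" where
  "blk_TT T X = T\<^sup>T * X * T"

definition blk_TN :: "real mat \<Rightarrow> real vec \<Rightarrow> real mat \<Rightarrow> real vec" where
  "blk_TN T \<nu> X = T\<^sup>T *\<^sub>v (X *\<^sub>v \<nu>)"

definition blk_NN :: "real vec \<Rightarrow> real mat \<Rightarrow> real" where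
  "blk_NN \<nu> X = \<nu> \<bullet> (X *\<^sub>v \<nu>)"

(* The block C_(t,T) equals w (I + t^2 q (x) q) with q the tangential part of Du, and
   similarly for the other blocks. *)
definition L_bd :: "real mat \<Rightarrow> real \<Rightarrow> real vec \<Rightarrow> real mat \<Rightarrow> real" where
  "L_bd T t p H =
     (let R = inv_sqrt_mat (blk_TT T (C_mat t p))
      in pi / 2 + phase (R * blk_TT T H * R))"

definition D_bd :: "real mat \<Rightarrow> real \<Rightarrow> real vec \<Rightarrow> real mat \<Rightarrow> complex mat" where
  "D_bd T t p H =
     map_mat complex_of_real (blk_TT T (C_mat t p)) + \<i> \<cdot>\<^sub>m map_mat complex_of_real (blk_TT T H)"

definition e_bd :: "real mat \<Rightarrow> real vec \<Rightarrow> real \<Rightarrow> real vec \<Rightarrow> real mat \<Rightarrow> complex vec" where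
  "e_bd T \<nu> t p H =
     map_vec complex_of_real (blk_TN T \<nu> (C_mat t p)) +
     \<i> \<cdot>\<^sub>v map_vec complex_of_real (blk_TN T \<nu> H)"

definition S_bd :: "real mat \<Rightarrow> real vec \<Rightarrow> real \<Rightarrow> real vec \<Rightarrow> real mat \<Rightarrow> complex" where
  "S_bd T \<nu> t p H = e_bd T \<nu> t p H \<bullet> (the (mat_inverse (D_bd T t p H)) *\<^sub>v e_bd T \<nu> t p H)"

definition alpha_bd :: "real mat \<Rightarrow> real vec \<Rightarrow> real \<Rightarrow> real vec \<Rightarrow> real mat \<Rightarrow> real" where
  "alpha_bd T \<nu> t p H = blk_NN \<nu> (C_mat t p) - Re (S_bd T \<nu> t p H)"

definition beta_bd :: "real mat \<Rightarrow> real vec \<Rightarrow> real \<Rightarrow> real vec \<Rightarrow> real mat \<Rightarrow> real" where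
  "beta_bd T \<nu> t p H = Im (S_bd T \<nu> t p H)"

definition delta_bd :: "real mat \<Rightarrow> real \<Rightarrow> real vec \<Rightarrow> real mat \<Rightarrow> real" where
  "delta_bd T t p H = L_bd T t p H - phase (A_mat t p H)"

(* arctan (a / b) with a / 0 read as +infinity. *)
definition arctan_quot :: "real \<Rightarrow> real \<Rightarrow> real" where
  "arctan_quot a b = (if b = 0 then pi / 2 else arctan (a / b))"

end

theory Submission
  imports Defs
begin

text \<open>
  Let \<open>D\<close> and \<open>e\<close> be the tangential block and the mixed block of \<open>K = C + i H\<close>, where \<open>C = C_mat t p\<close>.
  The Schur complement of \<open>D\<close> in \<open>K\<close> is \<open>\<sigma> = \<alpha> + i (r - \<beta>)\<close>.  With \<open>y = - D\<inverse> e\<close> and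
  \<open>v = T y + \<nu>\<close> the vector \<open>K v\<close> is orthogonal to the tangent space and has normal component \<open>\<sigma>\<close>,
  so \<open>\<sigma>\<close> is the value at \<open>v\<close> of the Hermitian form of \<open>K\<close>.  Since \<open>C \<ge> I\<close> and \<open>H \<ge> 0\<close>, this gives
  \<open>\<alpha> \<ge> |v|\<^sup>2 \<ge> 1\<close> and \<open>r - \<beta> \<ge> 0\<close>; likewise \<open>|y| \<le> |e|\<close>, which bounds \<open>S\<close> by \<open>|e|\<^sup>2\<close>.

  The phases are arguments of determinants, because \<open>det K\<close> and \<open>det D\<close> are positive multiples of
  the products of \<open>1 + i \<lambda>\<close> over the relevant eigenvalues.  Hence \<open>det K = \<sigma> det D\<close> determines
  the difference of the two phases modulo \<open>2 \<pi>\<close>.  To fix the branch, replace \<open>H\<close> by \<open>s H\<close> and let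
  \<open>s\<close> run from \<open>0\<close> to \<open>1\<close>: the difference is continuous in \<open>s\<close>, vanishes at \<open>s = 0\<close>, and its
  cosine stays positive.
\<close>

no_notation inner (infix \<open>\<bullet>\<close> 70)

section \<open>Symmetry of the Hessian\<close>

text \<open>The mean value theorem is applied twice, first in x to the increment in y, then in y to
  \<open>fx \<xi>\<close>. With the two variables exchanged the same double difference is expressed
  by the other mixed derivative.\<close>

lemma double_difference_eq:
  fixes f fx fxy :: "real \<Rightarrow> real \<Rightarrow> real"
  assumes h: "0 < h"
    and fx: "\<And>x y. \<lbrakk>a \<le> x; x \<le> a + h; b \<le> y; y \<le> b + h\<rbrakk> \<Longrightarrow>
               ((\<lambda>x. f x y) has_real_derivative fx x y) (at x)"
    and fxy: "\<And>x y. \<lbrakk>a \<le> x; x \<le> a + h; b \<le> y; y \<le> b + h\<rbrakk> \<Longrightarrow>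
               (fx x has_real_derivative fxy x y) (at y)"
  obtains \<xi> \<eta> where "a \<le> \<xi>" "\<xi> \<le> a + h" "b \<le> \<eta>" "\<eta> \<le> b + h"
    "f (a + h) (b + h) - f (a + h) b - f a (b + h) + f a b = h * (h * fxy \<xi> \<eta>)"
proof -
  define g where "g x = f x (b + h) - f x b" for x
  have "(g has_real_derivative fx x (b + h) - fx x b) (at x)" if "a \<le> x" "x \<le> a + h" for x
    unfolding g_def using that h by (intro DERIV_diff fx) auto
  then obtain \<xi> where xi: "a < \<xi>" "\<xi> < a + h"
    "g (a + h) - g a = h * (fx \<xi> (b + h) - fx \<xi> b)"
    using MVT2[of a "a + h" g "\<lambda>x. fx x (b + h) - fx x b"] h by auto
  have "(fx \<xi> has_real_derivative fxy \<xi> y) (at y)" if "b \<le> y" "y \<le> b + h" for y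
    using that xi by (intro fxy) auto
  then obtain \<eta> where "b < \<eta>" "\<eta> < b + h" "fx \<xi> (b + h) - fx \<xi> b = h * fxy \<xi> \<eta>"
    using MVT2[of b "b + h" "fx \<xi>" "fxy \<xi>"] h by auto
  with xi show ?thesis by (intro that[of \<xi> \<eta>]) (auto simp: g_def)
qed

text \<open>Schwarz's theorem. Both mixed derivatives, at points near (a, b), equal the double
  difference divided by the square of h, so continuity at (a, b) forces equal values there.\<close>

lemma mixed_partials_eq:
  fixes f fx fy fxy fyx :: "real \<Rightarrow> real \<Rightarrow> real"
  assumes V: "open V" "(a, b) \<in> V"
    and fx: "\<And>x y. (x, y) \<in> V \<Longrightarrow> ((\<lambda>x. f x y) has_real_derivative fx x y) (at x)"
    and fy: "\<And>x y. (x, y) \<in> V \<Longrightarrow> (f x has_real_derivative fy x y) (at y)"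
    and fxy: "\<And>x y. (x, y) \<in> V \<Longrightarrow> (fx x has_real_derivative fxy x y) (at y)"
    and fyx: "\<And>x y. (x, y) \<in> V \<Longrightarrow> ((\<lambda>x. fy x y) has_real_derivative fyx x y) (at x)"
    and cxy: "continuous (at (a, b)) (\<lambda>(x, y). fxy x y)"
    and cyx: "continuous (at (a, b)) (\<lambda>(x, y). fyx x y)"
  shows "fxy a b = fyx a b"
proof (rule ccontr)
  assume ne: "fxy a b \<noteq> fyx a b"
  \<comment> \<open>Half the supposed gap: two values within e of \<open>fxy a b\<close> and of
    \<open>fyx a b\<close> cannot coincide.\<close>
  define e where "e = \<bar>fxy a b - fyx a b\<bar> / 2"
  have e: "e > 0" using ne by (simp add: e_def)
  obtain d0 where d0: "d0 > 0" "ball (a, b) d0 \<subseteq> V" using V open_contains_ball by blast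
  obtain d1 where d1: "d1 > 0" "\<And>z. dist z (a, b) < d1 \<Longrightarrow> \<bar>fxy (fst z) (snd z) - fxy a b\<bar> < e"
    using cxy[unfolded continuous_at_eps_delta, rule_format, OF e]
    by (auto simp: dist_real_def split_def)
  obtain d2 where d2: "d2 > 0" "\<And>z. dist z (a, b) < d2 \<Longrightarrow> \<bar>fyx (fst z) (snd z) - fyx a b\<bar> < e"
    using cyx[unfolded continuous_at_eps_delta, rule_format, OF e]
    by (auto simp: dist_real_def split_def)
  define d where "d = min d0 (min d1 d2)"
  have d: "d > 0" using d0 d1 d2 by (simp add: d_def)
  \<comment> \<open>A point of the square of side h is at distance at most 2 h < d from the corner
    (a, b).\<close>
  define h where "h = d / 3"
  have h: "h > 0" using d by (simp add: h_def)
  have near: "dist (x, y) (a, b) < d" if "a \<le> x" "x \<le> a + h" "b \<le> y" "y \<le> b + h" for x y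
  proof -
    have "dist (x, y) (a, b) \<le> \<bar>x - a\<bar> + \<bar>y - b\<bar>"
      using sqrt_sum_squares_le_sum_abs[of "x - a" "y - b"] by (simp add: dist_Pair_Pair dist_real_def)
    also have "\<dots> < d" using that d by (simp add: h_def)
    finally show ?thesis .
  qed
  have inV: "(x, y) \<in> V" if "a \<le> x" "x \<le> a + h" "b \<le> y" "y \<le> b + h" for x y
    using near[OF that] d0 by (auto simp: d_def dist_commute)
  obtain \<xi> \<eta> where 1: "a \<le> \<xi>" "\<xi> \<le> a + h" "b \<le> \<eta>" "\<eta> \<le> b + h"
    "f (a + h) (b + h) - f (a + h) b - f a (b + h) + f a b = h * (h * fxy \<xi> \<eta>)"
    by (rule double_difference_eq[of h a b f fx fxy, OF h fx[OF inV] fxy[OF inV]])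
  obtain \<eta>' \<xi>' where 2: "b \<le> \<eta>'" "\<eta>' \<le> b + h" "a \<le> \<xi>'" "\<xi>' \<le> a + h"
    "f (a + h) (b + h) - f a (b + h) - f (a + h) b + f a b = h * (h * fyx \<xi>' \<eta>')"
    by (rule double_difference_eq[of h b a "\<lambda>y x. f x y" "\<lambda>y x. fy x y" "\<lambda>y x. fyx x y",
          OF h fy[OF inV] fyx[OF inV]])
  have "h * (h * fxy \<xi> \<eta>) = h * (h * fyx \<xi>' \<eta>')" using 1(5) 2(5) by linarith
  then have "fxy \<xi> \<eta> = fyx \<xi>' \<eta>'" using h by simp
  moreover have "\<bar>fxy \<xi> \<eta> - fxy a b\<bar> < e" using d1(2)[of "(\<xi>, \<eta>)"] near[OF 1(1-4)] by (simp add: d_def)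
  moreover have "\<bar>fyx \<xi>' \<eta>' - fyx a b\<bar> < e"
    using d2(2)[of "(\<xi>', \<eta>')"] near[OF 2(3,4,1,2)] by (simp add: d_def)
  ultimately have "\<bar>fxy a b - fyx a b\<bar> < 2 * e" unfolding abs_less_iff by linarith
  then show False by (simp add: e_def)
qed

text \<open>Reduction to two variables: u is restricted to the plane through x in the directions i
  and j.\<close>

lemma pd_commute:
  assumes \<Omega>: "openin (Euclidean_space n) \<Omega>" and u: "Ck_on n 2 \<Omega> u"
    and i: "i < n" and j: "j < n" and x: "x \<in> \<Omega>"
  shows "pd i (pd j u) x = pd j (pd i u) x"
proof (cases "i = j")
  case False
  \<comment> \<open>The remaining coordinates stay those of x, so \<open>\<phi>\<close> is
    continuous into \<open>Euclidean_space n\<close> and the preimage V of \<open>\<Omega>\<close>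
    is open.\<close>
  define \<phi> where "\<phi> z = x(i := fst z, j := snd z)" for z :: "real \<times> real"
  define V where "V = {z. \<phi> z \<in> \<Omega>}"
  have \<Omega>_sub: "\<Omega> \<subseteq> {x. \<forall>i\<ge>n. x i = 0}"
    using openin_subset[OF \<Omega>] by (simp add: topspace_Euclidean_space)
  have cont_\<phi>: "continuous_map euclidean (Euclidean_space n) \<phi>"
    unfolding Euclidean_space_def continuous_map_in_subtopology continuous_map_componentwise_UNIV
  proof (intro conjI allI)
    fix k
    have "continuous_on UNIV (\<lambda>z. \<phi> z k)"
      unfolding \<phi>_def by (cases "k = j"; cases "k = i") (simp_all add: continuous_on_fst continuous_on_snd)
    then show "continuous_map euclidean euclideanreal (\<lambda>z. \<phi> z k)" by simp
  next
    have "\<forall>k\<ge>n. x k = 0" using \<Omega>_sub x by blast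
    then show "\<phi> \<in> topspace euclidean \<rightarrow> {x. \<forall>i\<ge>n. x i = 0}"
      using i j by (auto simp: \<phi>_def)
  qed
  have "openin euclidean V"
    using openin_continuous_map_preimage[OF cont_\<phi> \<Omega>] by (simp add: V_def)
  then have V: "open V" by simp
  have x_eq: "\<phi> (x i, x j) = x" by (auto simp: \<phi>_def fun_eq_iff)
  have xV: "(x i, x j) \<in> V" using x by (simp add: V_def x_eq)
  have 2: "Ck_on n 1 \<Omega> (pd k u)" "\<And>y. y \<in> \<Omega> \<Longrightarrow> (\<lambda>h. u (y(k := h))) differentiable (at (y k))"
    if "k < n" for k using u that by (auto simp: numeral_2_eq_2)
  have 1: "(\<lambda>h. pd l u (y(k := h))) differentiable (at (y k))"
    if "k < n" "l < n" "y \<in> \<Omega>" for k l y using 2(1)[OF that(2)] that by auto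
  have 0: "continuous_map (subtopology (Euclidean_space n) \<Omega>) euclideanreal (pd k (pd l u))"
    if "k < n" "l < n" for k l using 2(1)[OF that(2)] that by auto
  have cont: "continuous (at (x i, x j)) (\<lambda>(a, b). pd k (pd l u) (\<phi> (a, b)))"
    if "k < n" "l < n" for k l
  proof -
    have "continuous_map (subtopology euclidean V) (subtopology (Euclidean_space n) \<Omega>) \<phi>"
      unfolding continuous_map_in_subtopology
      using continuous_map_from_subtopology[OF cont_\<phi>] by (auto simp: V_def)
    from continuous_map_compose[OF this 0[OF that]]
    have "continuous_on V (\<lambda>z. pd k (pd l u) (\<phi> z))" by (simp add: o_def)
    then show ?thesis using V xV by (simp add: continuous_on_eq_continuous_at split_def)
  qed
  have i_upd: "(\<phi> (a, b))(i := h) = \<phi> (h, b)" and j_upd: "(\<phi> (a, b))(j := h) = \<phi> (a, h)"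
    and at_i: "\<phi> (a, b) i = a" and at_j: "\<phi> (a, b) j = b" for a b h
    using False by (auto simp: \<phi>_def fun_eq_iff)
  have Di: "((\<lambda>a. g (\<phi> (a, b))) has_real_derivative pd i g (\<phi> (a, b))) (at a)"
    if "\<And>y. y \<in> \<Omega> \<Longrightarrow> (\<lambda>h. g (y(i := h))) differentiable (at (y i))" "(a, b) \<in> V" for g a b
    using that(1)[of "\<phi> (a, b)"] that(2)
    by (simp add: V_def pd_def i_upd at_i DERIV_deriv_iff_real_differentiable)
  have Dj: "((\<lambda>b. g (\<phi> (a, b))) has_real_derivative pd j g (\<phi> (a, b))) (at b)"
    if "\<And>y. y \<in> \<Omega> \<Longrightarrow> (\<lambda>h. g (y(j := h))) differentiable (at (y j))" "(a, b) \<in> V" for g a b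
    using that(1)[of "\<phi> (a, b)"] that(2)
    by (simp add: V_def pd_def j_upd at_j DERIV_deriv_iff_real_differentiable)
  have "pd j (pd i u) (\<phi> (x i, x j)) = pd i (pd j u) (\<phi> (x i, x j))"
  proof (rule mixed_partials_eq[OF V xV, of "\<lambda>a b. u (\<phi> (a, b))" "\<lambda>a b. pd i u (\<phi> (a, b))"
        "\<lambda>a b. pd j u (\<phi> (a, b))" "\<lambda>a b. pd j (pd i u) (\<phi> (a, b))"
        "\<lambda>a b. pd i (pd j u) (\<phi> (a, b))"])
    fix a b assume ab: "(a, b) \<in> V"
    show "((\<lambda>a. u (\<phi> (a, b))) has_real_derivative pd i u (\<phi> (a, b))) (at a)"
      by (rule Di[OF 2(2)[OF i] ab])
    show "((\<lambda>b. u (\<phi> (a, b))) has_real_derivative pd j u (\<phi> (a, b))) (at b)"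
      by (rule Dj[OF 2(2)[OF j] ab])
    show "((\<lambda>b. pd i u (\<phi> (a, b))) has_real_derivative pd j (pd i u) (\<phi> (a, b))) (at b)"
      by (rule Dj[OF 1[OF j i] ab])
    show "((\<lambda>a. pd j u (\<phi> (a, b))) has_real_derivative pd i (pd j u) (\<phi> (a, b))) (at a)"
      by (rule Di[OF 1[OF i j] ab])
  qed (rule cont[OF j i] cont[OF i j])+
  then show ?thesis by (simp add: x_eq)
qed simp

text \<open>\<open>nonneg_form\<close> does not include symmetry, so it is obtained here from the
  interior, where the second derivatives commute; this covers boundary points because the entries
  are limits taken inside \<open>\<Omega>\<close>.\<close>

lemma D2u_symmetric:
  assumes "openin (Euclidean_space n) \<Omega>" "Ck_on n 2 \<Omega> u"
  shows "(D2u n \<Omega> u x)\<^sup>T = D2u n \<Omega> u x"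
proof (rule eq_matI)
  fix i j assume "i < dim_row (D2u n \<Omega> u x)" "j < dim_col (D2u n \<Omega> u x)"
  then have ij: "i < n" "j < n" by (auto simp: D2u_def)
  let ?F = "atin_within (Euclidean_space n) x \<Omega>"
  have "\<forall>\<^sub>F y in ?F. pd i (pd j u) y = pd j (pd i u) y"
    using pd_commute[OF assms ij] openin_topspace unfolding eventually_atin_within by metis
  then have "(pd i (pd j u) \<longlongrightarrow> l) ?F \<longleftrightarrow> (pd j (pd i u) \<longlongrightarrow> l) ?F" for l
    by (rule tendsto_cong)
  \<comment> \<open>\<open>Lim\<close> is a definite description, so having the same limits gives
    the same value, whether or not a limit exists.\<close>
  then have "Lim ?F (pd i (pd j u)) = Lim ?F (pd j (pd i u))"
    by (simp add: t2_space_class.Lim_def)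
  then show "(D2u n \<Omega> u x)\<^sup>T $$ (i, j) = D2u n \<Omega> u x $$ (i, j)"
    using ij by (simp add: D2u_def)
qed (auto simp: D2u_def)

section \<open>Spectra of symmetric matrices and arguments of determinants\<close>

abbreviation cvec :: "real vec \<Rightarrow> complex vec" where "cvec \<equiv> map_vec complex_of_real"
abbreviation cmat :: "real mat \<Rightarrow> complex mat" where "cmat \<equiv> map_mat complex_of_real"

lemma scalar_prod_sum: "v \<in> carrier_vec n \<Longrightarrow> u \<bullet> v = (\<Sum>i<n. u $ i * v $ i)"
  by (simp add: scalar_prod_def atLeast0LessThan)

lemma quadratic_form_sum:
  assumes "X \<in> carrier_mat n n" "v \<in> carrier_vec n" "u \<in> carrier_vec n"
  shows "u \<bullet> (X *\<^sub>v v) = (\<Sum>i<n. \<Sum>j<n. u $ i * (X $$ (i, j) * v $ j))"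
  using assms by (simp add: scalar_prod_def atLeast0LessThan sum_distrib_left)

text \<open>The mixed terms in Re v and Im v cancel by symmetry of X, so the form is real. This is
  used both for the reality of eigenvalues and for separating C from H in a pencil.\<close>

lemma hermitian_form:
  assumes X: "X \<in> carrier_mat n n" "X\<^sup>T = X" and v: "v \<in> carrier_vec n"
  shows "map_vec cnj v \<bullet> (cmat X *\<^sub>v v) = complex_of_real
    (map_vec Re v \<bullet> (X *\<^sub>v map_vec Re v) + map_vec Im v \<bullet> (X *\<^sub>v map_vec Im v))"
proof (rule complex_eqI)
  have sym: "X $$ (i, j) = X $$ (j, i)" if "i < n" "j < n" for i j
    using X that by (metis carrier_matD index_transpose_mat(1))
  have *: "map_vec cnj v \<bullet> (cmat X *\<^sub>v v) =
      (\<Sum>i<n. \<Sum>j<n. cnj (v $ i) * (complex_of_real (X $$ (i, j)) * v $ j))"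
    using X v by (subst quadratic_form_sum[of _ n]) auto
  show "Re (map_vec cnj v \<bullet> (cmat X *\<^sub>v v)) = Re (complex_of_real
    (map_vec Re v \<bullet> (X *\<^sub>v map_vec Re v) + map_vec Im v \<bullet> (X *\<^sub>v map_vec Im v)))"
    using X v unfolding * by (simp add: quadratic_form_sum[of _ n] sum.distrib algebra_simps)
  \<comment> \<open>Exchanging i and j turns one half of the imaginary part into the other, with the
    opposite sign.\<close>
  have "(\<Sum>i<n. \<Sum>j<n. Re (v $ i) * (X $$ (i, j) * Im (v $ j)))
      = (\<Sum>j<n. \<Sum>i<n. Re (v $ i) * (X $$ (i, j) * Im (v $ j)))"
    by (rule sum.swap)
  also have "\<dots> = (\<Sum>i<n. \<Sum>j<n. Im (v $ i) * (X $$ (i, j) * Re (v $ j)))"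
    by (intro sum.cong refl) (simp add: sym mult.commute mult.left_commute)
  finally show "Im (map_vec cnj v \<bullet> (cmat X *\<^sub>v v)) = Im (complex_of_real
    (map_vec Re v \<bullet> (X *\<^sub>v map_vec Re v) + map_vec Im v \<bullet> (X *\<^sub>v map_vec Im v)))"
    unfolding * by (simp add: sum_subtractf)
qed

text \<open>The characteristic polynomial factors over the complex numbers; its roots are real
  because eigenvalue times squared norm of an eigenvector is a value of a real Hermitian form.
  Injectivity of \<open>of_real\<close> on polynomials brings the factorization back to the
  reals.\<close>

lemma real_symmetric_char_poly_splits:
  fixes X :: "real mat"
  assumes X: "X \<in> carrier_mat n n" "X\<^sup>T = X"
  obtains as where "length as = n" "char_poly X = (\<Prod>a\<leftarrow>as. [:- a, 1:])"
proof -
  have Xc: "cmat X \<in> carrier_mat n n" using X by simp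
  interpret h: map_poly_inj_idom_hom complex_of_real ..
  obtain cs where cs: "char_poly (cmat X) = (\<Prod>a\<leftarrow>cs. [:- a, 1:])" "length cs = n"
    using char_poly_factorized[OF Xc] by blast
  have real: "complex_of_real (Re c) = c" if c: "c \<in> set cs" for c
  proof -
    have "poly (char_poly (cmat X)) c = 0"
      using c unfolding cs poly_prod_list by (auto simp: prod_list_zero_iff)
    then have "eigenvalue (cmat X) c" using eigenvalue_root_char_poly[OF Xc] by simp
    then obtain v where v: "v \<in> carrier_vec n" "v \<noteq> 0\<^sub>v n" "cmat X *\<^sub>v v = c \<cdot>\<^sub>v v"
      using X by (auto simp: eigenvalue_def eigenvector_def)
    define N where "N = (\<Sum>i<n. (cmod (v $ i))\<^sup>2)"
    have "N \<noteq> 0"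
    proof
      assume "N = 0"
      then have "v $ i = 0" if "i < n" for i
        using that by (auto simp: N_def sum_nonneg_eq_0_iff)
      then have "v = 0\<^sub>v n" using v(1) by (intro eq_vecI) auto
      with v show False by simp
    qed
    have "map_vec cnj v \<bullet> v = complex_of_real N"
      using v(1) unfolding N_def scalar_prod_sum[OF v(1)] of_real_sum
      by (intro sum.cong refl) (simp add: mult.commute flip: complex_norm_square)
    then have "map_vec cnj v \<bullet> (cmat X *\<^sub>v v) = c * complex_of_real N"
      using v by simp
    then have "Im (c * complex_of_real N) = 0"
      unfolding hermitian_form[OF X v(1)] by (metis Im_complex_of_real)
    with \<open>N \<noteq> 0\<close> show ?thesis by (simp add: complex_eq_iff)
  qed
  have "map_poly complex_of_real (\<Prod>a\<leftarrow>map Re cs. [:- a, 1:]) = (\<Prod>a\<leftarrow>cs. [:- a, 1:])"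
    using real by (induction cs) (simp_all add: hom_distribs)
  also have "\<dots> = map_poly complex_of_real (char_poly X)"
    by (simp only: cs(1)[symmetric] of_real_hom.char_poly_hom[OF X(1)])
  finally have "(\<Prod>a\<leftarrow>map Re cs. [:- a, 1:]) = char_poly X" by simp
  with that[of "map Re cs"] cs show ?thesis by simp
qed

lemma phase_eq_sum_list:
  assumes "char_poly X = (\<Prod>a\<leftarrow>as. [:- a, 1:])"
  shows "phase X = (\<Sum>a\<leftarrow>as. arctan a)"
proof -
  have "proots (\<Prod>a\<leftarrow>as. [:- a, 1:]) = mset as"
  proof (induction as)
    case (Cons a as)
    have "(\<Prod>a\<leftarrow>as. [:- a, 1:]) \<noteq> 0" by (auto simp: prod_list_zero_iff)
    then have "proots ([:- a, 1:] * (\<Prod>a\<leftarrow>as. [:- a, 1:])) = {#a#} + mset as"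
      by (subst proots_mult) (simp_all add: Cons del: mult_pCons_left)
    then show ?case by simp
  qed simp
  then show ?thesis by (simp add: phase_def assms sum_mset_sum_list flip: mset_map)
qed

text \<open>For c nonzero, 1 + c X = (- c) (- 1 / c - X), so the determinant is a scaled value of
  the characteristic polynomial at - 1 / c.\<close>

lemma det_one_add_smult:
  fixes X :: "'a :: field mat"
  assumes X: "X \<in> carrier_mat n n" and as: "length as = n" "char_poly X = (\<Prod>a\<leftarrow>as. [:- a, 1:])"
  shows "det (1\<^sub>m n + c \<cdot>\<^sub>m X) = (\<Prod>a\<leftarrow>as. 1 + c * a)"
proof (cases "c = 0")
  case True
  have "1\<^sub>m n + 0 \<cdot>\<^sub>m X = 1\<^sub>m n" using X by (intro eq_matI) auto
  moreover have "(\<Prod>a\<leftarrow>as. 1 + 0 * a) = 1" by (induction as) auto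
  ultimately show ?thesis using True by simp
next
  case False
  have "1\<^sub>m n + c \<cdot>\<^sub>m X = (- c) \<cdot>\<^sub>m (- char_matrix X (- 1 / c))"
    using X False by (intro eq_matI) (auto simp: char_matrix_def field_simps)
  then have "det (1\<^sub>m n + c \<cdot>\<^sub>m X) = (- c) ^ n * poly (char_poly X) (- 1 / c)"
    using carrier_matD(2)[OF char_matrix_closed[OF X]] by (simp add: char_poly_matrix[OF X])
  also have "\<dots> = (\<Prod>a\<leftarrow>as. 1 + c * a)"
    unfolding as(2) as(1)[symmetric]
  proof (induction as)
    case (Cons a as)
    have "(- c) ^ length (a # as) * poly (\<Prod>a\<leftarrow>a # as. [:- a, 1:]) (- 1 / c) =
        (- c * (- a - 1 / c)) * ((- c) ^ length as * poly (\<Prod>a\<leftarrow>as. [:- a, 1:]) (- 1 / c))"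
      by (simp add: algebra_simps)
    also have "- c * (- a - 1 / c) = 1 + c * a" using False by (simp add: field_simps)
    also note Cons
    finally show ?case by (simp only: list.map prod_list.Cons)
  qed simp
  finally show ?thesis .
qed

text \<open>Each factor 1 + i x has modulus \<open>sqrt (1 + x\<^sup>2)\<close> and argument
  \<open>arctan x\<close>; in a product the arguments add up.\<close>

lemma prod_one_add_imag_polar:
  obtains R where "R > 0"
    "(\<Prod>a\<leftarrow>as. 1 + \<i> * complex_of_real (s * a)) = of_real R * cis (\<Sum>a\<leftarrow>as. arctan (s * a))"
proof -
  have 1: "1 + \<i> * complex_of_real x = of_real (sqrt (1 + x\<^sup>2)) * cis (arctan x)" for x
    by (simp add: complex_eq_iff cos_arctan sin_arctan add_nonneg_eq_0_iff)
  have "\<exists>R>0. (\<Prod>a\<leftarrow>as. 1 + \<i> * complex_of_real (s * a))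
      = of_real R * cis (\<Sum>a\<leftarrow>as. arctan (s * a))"
  proof (induction as)
    case Nil
    show ?case by (intro exI[of _ 1]) simp
  next
    case (Cons a as)
    then obtain R where R: "R > 0" "(\<Prod>a\<leftarrow>as. 1 + \<i> * complex_of_real (s * a))
      = of_real R * cis (\<Sum>a\<leftarrow>as. arctan (s * a))" by blast
    have "(\<Prod>a\<leftarrow>a # as. 1 + \<i> * complex_of_real (s * a)) =
        of_real (sqrt (1 + (s * a)\<^sup>2)) * cis (arctan (s * a)) *
        (of_real R * cis (\<Sum>a\<leftarrow>as. arctan (s * a)))"
      by (simp only: list.map prod_list.Cons R(2) 1[of "s * a"])
    also have "\<dots> = of_real (sqrt (1 + (s * a)\<^sup>2) * R) * cis (\<Sum>a\<leftarrow>a # as. arctan (s * a))"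
      unfolding list.map sum_list.Cons cis_mult[symmetric] of_real_mult by (simp only: mult_ac)
    finally show ?case
      using R(1) by (intro exI[of _ "sqrt (1 + (s * a)\<^sup>2) * R"]) (simp add: add_pos_nonneg)
  qed
  with that show ?thesis by blast
qed

text \<open>This fixes the branch of the argument. The difference F of the two sums is an argument
  of \<open>\<sigma> s\<close>, is continuous in s and starts at 0; as \<open>\<sigma>\<close> stays
  in the right half plane, F never reaches \<open>pi / 2\<close> or
  \<open>- (pi / 2)\<close>.\<close>

lemma sum_arctan_diff_eq_arctan:
  assumes \<sigma>: "\<And>s. \<lbrakk>0 \<le> s; s \<le> 1\<rbrakk> \<Longrightarrow> 0 < Re (\<sigma> s)"
    and k: "0 < k"
    and eq: "\<And>s. \<lbrakk>0 \<le> s; s \<le> 1\<rbrakk> \<Longrightarrow> (\<Prod>a\<leftarrow>as. 1 + \<i> * complex_of_real (s * a)) =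
        of_real k * \<sigma> s * (\<Prod>b\<leftarrow>bs. 1 + \<i> * complex_of_real (s * b))"
  shows "(\<Sum>a\<leftarrow>as. arctan a) - (\<Sum>b\<leftarrow>bs. arctan b) = arctan (Im (\<sigma> 1) / Re (\<sigma> 1))"
proof -
  define F where "F s = (\<Sum>a\<leftarrow>as. arctan (s * a)) - (\<Sum>b\<leftarrow>bs. arctan (s * b))" for s
  have cl: "continuous_on A (\<lambda>s. \<Sum>a\<leftarrow>l. arctan (s * a))" for l :: "real list" and A :: "real set"
    by (induction l) (auto intro!: continuous_intros)
  have cont: "continuous_on A F" for A
    unfolding F_def by (intro continuous_intros cl)
  have polar: "\<exists>R>0. \<sigma> s = of_real R * cis (F s)" if s: "0 \<le> s" "s \<le> 1" for s
  proof -
    obtain R1 where R1: "R1 > 0" "(\<Prod>a\<leftarrow>as. 1 + \<i> * complex_of_real (s * a))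
        = of_real R1 * cis (\<Sum>a\<leftarrow>as. arctan (s * a))" by (rule prod_one_add_imag_polar)
    obtain R2 where R2: "R2 > 0" "(\<Prod>b\<leftarrow>bs. 1 + \<i> * complex_of_real (s * b))
        = of_real R2 * cis (\<Sum>b\<leftarrow>bs. arctan (s * b))" by (rule prod_one_add_imag_polar)
    \<comment> \<open>Positive factors do not change arguments, so dividing the two polar forms
      leaves exactly the angle F s.\<close>
    have "\<sigma> s = of_real (R1 / (k * R2)) * cis (F s)"
      using eq[OF s] k R1(1) R2(1) unfolding R1(2) R2(2) F_def cis_divide[symmetric]
      by (simp add: field_simps)
    moreover have "R1 / (k * R2) > 0" using k R1 R2 by simp
    ultimately show ?thesis by blast
  qed
  have cos_pos: "cos (F s) > 0" if "0 \<le> s" "s \<le> 1" for s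
    using polar[OF that] \<sigma>[OF that] by (auto simp: zero_less_mult_iff)
  have F0: "F 0 = 0"
  proof -
    have "(\<Sum>a\<leftarrow>l. arctan (0 * a)) = 0" for l :: "real list" by (induction l) auto
    then show ?thesis by (simp only: F_def diff_self)
  qed
  have "F 1 < pi / 2"
  proof (rule ccontr)
    assume "\<not> F 1 < pi / 2"
    then obtain s where "0 \<le> s" "s \<le> 1" "F s = pi / 2"
      using IVT'[of F 0 "pi / 2" 1] cont F0 by auto
    with cos_pos[of s] show False by simp
  qed
  moreover have "- (pi / 2) < F 1"
  proof (rule ccontr)
    assume "\<not> - (pi / 2) < F 1"
    then obtain s where "0 \<le> s" "s \<le> 1" "F s = - (pi / 2)"
      using IVT2'[of F 1 "- (pi / 2)" 0] cont F0 by auto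
    with cos_pos[of s] show False by simp
  qed
  moreover obtain R where R: "R > 0" "\<sigma> 1 = of_real R * cis (F 1)" using polar[of 1] by auto
  then have "Im (\<sigma> 1) / Re (\<sigma> 1) = tan (F 1)" by (simp add: tan_def)
  ultimately have "arctan (Im (\<sigma> 1) / Re (\<sigma> 1)) = F 1" by (simp add: arctan_tan)
  then show ?thesis by (simp add: F_def)
qed

section \<open>Complex symmetric pencils\<close>

definition csq :: "complex vec \<Rightarrow> real" where
  "csq v = (\<Sum>i<dim_vec v. (cmod (v $ i))\<^sup>2)"

abbreviation pencil :: "real mat \<Rightarrow> real mat \<Rightarrow> complex mat" where
  "pencil C H \<equiv> cmat C + \<i> \<cdot>\<^sub>m cmat H"

text \<open>This is C \<ge> I as quadratic forms. The constant 1 is what later yields both 1 \<le>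
  \<alpha> and |S| \<le> |e|^2 without further factors.\<close>

definition coercive :: "real mat \<Rightarrow> bool" where
  "coercive C \<longleftrightarrow> (\<forall>v\<in>carrier_vec (dim_row C). v \<bullet> v \<le> v \<bullet> (C *\<^sub>v v))"

lemma csq_nonneg: "0 \<le> csq v" by (simp add: csq_def sum_nonneg)

lemma csq_eq_Re_Im: "csq v = map_vec Re v \<bullet> map_vec Re v + map_vec Im v \<bullet> map_vec Im v"
  by (simp add: csq_def scalar_prod_def atLeast0LessThan cmod_power2 sum.distrib
      flip: power2_eq_square)

text \<open>The arithmetic-geometric form of Cauchy-Schwarz. It stays linear in the squared norms,
  so terms can be absorbed without taking roots.\<close>

lemma cmod_scalar_prod_le:
  assumes "u \<in> carrier_vec n" "v \<in> carrier_vec n"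
  shows "cmod (u \<bullet> v) \<le> (csq u + csq v) / 2"
proof -
  have "cmod (u \<bullet> v) \<le> (\<Sum>i<n. cmod (u $ i * v $ i))"
    unfolding scalar_prod_sum[OF assms(2)] by (rule norm_sum)
  also have "\<dots> \<le> (\<Sum>i<n. ((cmod (u $ i))\<^sup>2 + (cmod (v $ i))\<^sup>2) / 2)"
  proof (rule sum_mono)
    fix i
    show "cmod (u $ i * v $ i) \<le> ((cmod (u $ i))\<^sup>2 + (cmod (v $ i))\<^sup>2) / 2"
      using sum_squares_bound[of "cmod (u $ i)" "cmod (v $ i)"] by (simp add: norm_mult)
  qed
  also have "\<dots> = (csq u + csq v) / 2"
    using assms by (simp add: csq_def sum.distrib sum_divide_distrib[symmetric])
  finally show ?thesis .
qed

lemma pencil_mult_vec: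
  assumes "C \<in> carrier_mat n n" "H \<in> carrier_mat n n" "v \<in> carrier_vec n"
  shows "pencil C H *\<^sub>v v = cmat C *\<^sub>v v + \<i> \<cdot>\<^sub>v (cmat H *\<^sub>v v)"
  using assms by (intro eq_vecI) (auto simp: add_scalar_prod_distrib[of _ n])

text \<open>The Hermitian forms of C and H are both real, so they are the real and the imaginary
  part of the form of the pencil.\<close>

lemma pencil_form:
  assumes "C \<in> carrier_mat n n" "C\<^sup>T = C" "H \<in> carrier_mat n n" "H\<^sup>T = H" "v \<in> carrier_vec n"
  shows "map_vec cnj v \<bullet> (pencil C H *\<^sub>v v) =
    Complex (map_vec Re v \<bullet> (C *\<^sub>v map_vec Re v) + map_vec Im v \<bullet> (C *\<^sub>v map_vec Im v))
            (map_vec Re v \<bullet> (H *\<^sub>v map_vec Re v) + map_vec Im v \<bullet> (H *\<^sub>v map_vec Im v))"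
proof -
  have "map_vec cnj v \<bullet> (pencil C H *\<^sub>v v) =
      map_vec cnj v \<bullet> (cmat C *\<^sub>v v) + \<i> * (map_vec cnj v \<bullet> (cmat H *\<^sub>v v))"
    unfolding pencil_mult_vec[OF assms(1,3,5)] using assms
    by (subst scalar_prod_add_distrib[of _ n]) auto
  then show ?thesis
    using assms by (simp add: hermitian_form[of _ n] complex_eq_iff)
qed

lemma csq_le_pencil_form:
  assumes "C \<in> carrier_mat n n" "C\<^sup>T = C" "H \<in> carrier_mat n n" "H\<^sup>T = H" "v \<in> carrier_vec n"
    and "coercive C"
  shows "csq v \<le> Re (map_vec cnj v \<bullet> (pencil C H *\<^sub>v v))"
proof -
  have "map_vec Re v \<bullet> map_vec Re v \<le> map_vec Re v \<bullet> (C *\<^sub>v map_vec Re v)"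
    "map_vec Im v \<bullet> map_vec Im v \<le> map_vec Im v \<bullet> (C *\<^sub>v map_vec Im v)"
    using assms by (auto simp: coercive_def)
  then show ?thesis using assms by (simp add: pencil_form[of _ n] csq_eq_Re_Im)
qed

text \<open>With K the pencil, |v|^2 \<le> |v* K v| \<le> (|v|^2 + |K v|^2) / 2, and the term in v
  is absorbed on the left. Thus K is injective and its inverse does not increase norms.\<close>

lemma csq_solution_le:
  assumes CH: "C \<in> carrier_mat n n" "C\<^sup>T = C" "H \<in> carrier_mat n n" "H\<^sup>T = H"
    and v: "v \<in> carrier_vec n" and "coercive C"
  shows "csq v \<le> csq (pencil C H *\<^sub>v v)"
proof -
  have "csq v \<le> cmod (map_vec cnj v \<bullet> (pencil C H *\<^sub>v v))"
    using csq_le_pencil_form[OF assms] complex_Re_le_cmod order_trans by blast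
  also have "\<dots> \<le> (csq (map_vec cnj v) + csq (pencil C H *\<^sub>v v)) / 2"
    using CH v by (intro cmod_scalar_prod_le[of _ n] mult_mat_vec_carrier[of _ n n]) auto
  also have "csq (map_vec cnj v) = csq v" by (simp add: csq_def)
  finally show ?thesis by simp
qed

lemma det_pencil_nonzero:
  assumes CH: "C \<in> carrier_mat n n" "C\<^sup>T = C" "H \<in> carrier_mat n n" "H\<^sup>T = H" and "coercive C"
  shows "det (pencil C H) \<noteq> 0"
proof
  assume "det (pencil C H) = 0"
  then obtain v where v: "v \<in> carrier_vec n" "v \<noteq> 0\<^sub>v n" "pencil C H *\<^sub>v v = 0\<^sub>v n"
    using det_0_iff_vec_prod_zero_field[of "pencil C H" n] CH by auto
  then have "csq v \<le> 0"
    using csq_solution_le[OF CH v(1) \<open>coercive C\<close>] by (simp add: csq_def)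
  then have "csq v = 0" using csq_nonneg[of v] by simp
  then have "v $ i = 0" if "i < n" for i
    using that v(1) by (auto simp: csq_def sum_nonneg_eq_0_iff)
  then have "v = 0\<^sub>v n" using v(1) by (intro eq_vecI) auto
  with v(2) show False by simp
qed

text \<open>Makes \<open>the (mat_inverse X)\<close> meaningful: a nonzero determinant rules out the
  value \<open>None\<close>.\<close>

lemma the_mat_inverse:
  fixes X :: "'a :: field mat"
  assumes X: "X \<in> carrier_mat n n" and "det X \<noteq> 0"
  shows "the (mat_inverse X) \<in> carrier_mat n n" "X * the (mat_inverse X) = 1\<^sub>m n"
proof -
  have "X \<in> Units (ring_mat TYPE('a) n undefined)"
    by (rule det_non_zero_imp_unit[OF assms])
  then obtain Y where "mat_inverse X = Some Y"
    using mat_inverse(1)[OF X, of undefined] by (cases "mat_inverse X") auto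
  then show "the (mat_inverse X) \<in> carrier_mat n n" "X * the (mat_inverse X) = 1\<^sub>m n"
    using mat_inverse(2)[OF X] by auto
qed

section \<open>Bordered frames, tangential and normal blocks, and the Schur complement\<close>

definition snoc_col :: "'a mat \<Rightarrow> 'a vec \<Rightarrow> 'a mat" where
  "snoc_col T v = Matrix.mat (dim_row T) (Suc (dim_col T))
     (\<lambda>(i, j). if j < dim_col T then T $$ (i, j) else v $ i)"

lemma snoc_col_carrier: "T \<in> carrier_mat n m \<Longrightarrow> snoc_col T v \<in> carrier_mat n (Suc m)"
  by (simp add: snoc_col_def carrier_matD)

lemma col_snoc_col:
  assumes "T \<in> carrier_mat n m" "v \<in> carrier_vec n" "j < Suc m"
  shows "col (snoc_col T v) j = (if j < m then col T j else v)"
  using assms by (intro eq_vecI) (auto simp: snoc_col_def)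

lemma index_congruence:
  fixes X :: "'a :: comm_semiring_0 mat"
  assumes "A \<in> carrier_mat n k" "X \<in> carrier_mat n n" "B \<in> carrier_mat n l" "i < k" "j < l"
  shows "(A\<^sup>T * (X * B)) $$ (i, j) = col A i \<bullet> (X *\<^sub>v col B j)"
  using assms by (simp add: col_mult2[of X n n B l] del: col_mult)

text \<open>The last columns on the left and on the right may differ. This freedom lets a product
  become block triangular, from which its determinant is read off.\<close>

lemma snoc_col_congruence:
  fixes X :: "'a :: comm_semiring_0 mat"
  assumes T: "T \<in> carrier_mat n m" and X: "X \<in> carrier_mat n n"
    and v: "v \<in> carrier_vec n" and w: "w \<in> carrier_vec n"
  shows "(snoc_col T v)\<^sup>T * (X * snoc_col T w) =
    four_block_mat (T\<^sup>T * (X * T)) (Matrix.mat m 1 (\<lambda>(i, j). (T\<^sup>T *\<^sub>v (X *\<^sub>v w)) $ i))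
      (Matrix.mat 1 m (\<lambda>(i, j). v \<bullet> (X *\<^sub>v col T j))) (Matrix.mat 1 1 (\<lambda>_. v \<bullet> (X *\<^sub>v w)))"
    (is "_ = ?R")
proof (rule eq_matI)
  have R: "?R \<in> carrier_mat (m + 1) (m + 1)" using T X by (intro four_block_carrier_mat) auto
  fix i j assume "i < dim_row ?R" "j < dim_col ?R"
  then have ij: "i < Suc m" "j < Suc m" using R T by auto
  show "((snoc_col T v)\<^sup>T * (X * snoc_col T w)) $$ (i, j) = ?R $$ (i, j)"
    using ij T X v w
    by (subst index_congruence[OF snoc_col_carrier[OF T] X snoc_col_carrier[OF T]])
      (auto simp: col_snoc_col[OF T] index_congruence[OF T X T] simp del: index_mult_mat(1))
qed (use T X in \<open>auto simp: snoc_col_def\<close>)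

text \<open>For C = \<open>C_mat t p\<close> this is \<alpha> + i (r - \<beta>). Both matrices are
  arguments, so that H can be rescaled while C stays fixed.\<close>

definition schur_compl :: "real mat \<Rightarrow> real vec \<Rightarrow> real mat \<Rightarrow> real mat \<Rightarrow> complex" where
  "schur_compl T \<nu> C H =
     (let e = cvec (blk_TN T \<nu> C) + \<i> \<cdot>\<^sub>v cvec (blk_TN T \<nu> H)
      in Complex (blk_NN \<nu> C) (blk_NN \<nu> H) -
         e \<bullet> (the (mat_inverse (pencil (blk_TT T C) (blk_TT T H))) *\<^sub>v e))"

lemma pencil_carrier [simp]:
  "\<lbrakk>C \<in> carrier_mat n n; H \<in> carrier_mat n n\<rbrakk> \<Longrightarrow> pencil C H \<in> carrier_mat n n"
  by simp

lemma blk_TT_carrier [simp]: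
  "\<lbrakk>T \<in> carrier_mat n m; X \<in> carrier_mat n n\<rbrakk> \<Longrightarrow> blk_TT T X \<in> carrier_mat m m"
  by (simp add: blk_TT_def)

lemma blk_TN_carrier [simp]:
  "T \<in> carrier_mat n m \<Longrightarrow> blk_TN T \<nu> X \<in> carrier_vec m"
  by (auto intro!: carrier_vecI simp: blk_TN_def)

lemma blk_TT_symmetric:
  assumes "T \<in> carrier_mat n m" "X \<in> carrier_mat n n" "X\<^sup>T = X"
  shows "(blk_TT T X)\<^sup>T = blk_TT T X"
  using assms by (simp add: blk_TT_def transpose_mult[of _ m n _ m] transpose_mult[of _ n n _ m]
      assoc_mult_mat[of _ m n _ n _ m])

lemma blk_TT_form:
  assumes T: "T \<in> carrier_mat n m" and X: "X \<in> carrier_mat n n" and v: "v \<in> carrier_vec m"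
  shows "v \<bullet> (blk_TT T X *\<^sub>v v) = (T *\<^sub>v v) \<bullet> (X *\<^sub>v (T *\<^sub>v v))"
proof -
  have "blk_TT T X *\<^sub>v v = T\<^sup>T *\<^sub>v (X *\<^sub>v (T *\<^sub>v v))"
    unfolding blk_TT_def using assms
    by (simp add: assoc_mult_mat_vec[of _ m n _ m] assoc_mult_mat_vec[of _ m n _ n])
  then show ?thesis
    using transpose_vec_mult_scalar[of "T\<^sup>T" m n "X *\<^sub>v (T *\<^sub>v v)" v] assms by simp
qed

lemma frame_isometry:
  fixes v :: "real vec"
  assumes T: "T \<in> carrier_mat n m" "T\<^sup>T * T = 1\<^sub>m m" and v: "v \<in> carrier_vec m"
  shows "(T *\<^sub>v v) \<bullet> (T *\<^sub>v v) = v \<bullet> v"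
proof -
  have "(T *\<^sub>v v) \<bullet> (T *\<^sub>v v) = v \<bullet> ((T\<^sup>T * T) *\<^sub>v v)"
    using transpose_vec_mult_scalar[of "T\<^sup>T" m n "T *\<^sub>v v" v] T(1) v
    by (simp add: assoc_mult_mat_vec[of _ m n _ m])
  then show ?thesis using T v by simp
qed

lemma blk_TT_coercive:
  assumes T: "T \<in> carrier_mat n m" "T\<^sup>T * T = 1\<^sub>m m" and X: "X \<in> carrier_mat n n" "coercive X"
  shows "coercive (blk_TT T X)"
  unfolding coercive_def
proof
  fix v :: "real vec" assume "v \<in> carrier_vec (dim_row (blk_TT T X))"
  then have v: "v \<in> carrier_vec m" using T by (simp add: blk_TT_def)
  then have "T *\<^sub>v v \<in> carrier_vec (dim_row X)" using T X by auto
  with X(2) have "(T *\<^sub>v v) \<bullet> (T *\<^sub>v v) \<le> (T *\<^sub>v v) \<bullet> (X *\<^sub>v (T *\<^sub>v v))"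
    unfolding coercive_def by blast
  then show "v \<bullet> v \<le> v \<bullet> (blk_TT T X *\<^sub>v v)"
    by (simp only: frame_isometry[OF T v] blk_TT_form[OF T(1) X(1) v])
qed

text \<open>The pencil is symmetric for the bilinear product, though in general not Hermitian; hence
  the bilinear transpose in S.\<close>

lemma pencil_symmetric:
  assumes "C\<^sup>T = C" "H\<^sup>T = H" "C \<in> carrier_mat n n" "H \<in> carrier_mat n n"
  shows "(pencil C H)\<^sup>T = pencil C H"
proof -
  have "(cmat C)\<^sup>T = cmat C" "(cmat H)\<^sup>T = cmat H" by (simp_all add: map_mat_transpose assms)
  moreover have "(\<i> \<cdot>\<^sub>m cmat H)\<^sup>T = \<i> \<cdot>\<^sub>m (cmat H)\<^sup>T" by (intro eq_matI) auto
  ultimately show ?thesis using assms by (simp add: transpose_add[of _ n n])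
qed

lemma pencil_blk_TT:
  assumes T: "T \<in> carrier_mat n m" and C: "C \<in> carrier_mat n n" and H: "H \<in> carrier_mat n n"
  shows "(cmat T)\<^sup>T * (pencil C H * cmat T) = pencil (blk_TT T C) (blk_TT T H)"
proof -
  have h: "cmat (blk_TT T X) = (cmat T)\<^sup>T * (cmat X * cmat T)" if "X \<in> carrier_mat n n" for X
    using T that unfolding blk_TT_def
    by (simp add: of_real_hom.mat_hom_mult[of _ m n _ m] of_real_hom.mat_hom_mult[of _ n n _ m]
        map_mat_transpose assoc_mult_mat[of _ m n _ n _ m])
  have "pencil C H * cmat T = cmat C * cmat T + \<i> \<cdot>\<^sub>m (cmat H * cmat T)"
    using T C H by (simp add: add_mult_distrib_mat[of _ n n] mult_smult_assoc_mat[of _ n n])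
  then show ?thesis using T C H unfolding h[OF C] h[OF H]
    by (simp add: mult_add_distrib_mat[of _ m n _ m] mult_smult_distrib[of _ m n _ m])
qed

lemma pencil_blk_TN:
  assumes T: "T \<in> carrier_mat n m" and C: "C \<in> carrier_mat n n" and H: "H \<in> carrier_mat n n"
    and \<nu>: "\<nu> \<in> carrier_vec n"
  shows "(cmat T)\<^sup>T *\<^sub>v (pencil C H *\<^sub>v cvec \<nu>) = cvec (blk_TN T \<nu> C) + \<i> \<cdot>\<^sub>v cvec (blk_TN T \<nu> H)"
proof -
  have h: "cvec (blk_TN T \<nu> X) = (cmat T)\<^sup>T *\<^sub>v (cmat X *\<^sub>v cvec \<nu>)" if "X \<in> carrier_mat n n" for X
    using T that \<nu> unfolding blk_TN_def
    by (simp add: of_real_hom.mult_mat_vec_hom[of _ m n] of_real_hom.mult_mat_vec_hom[of _ n n]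
        map_mat_transpose)
  have c: "cmat X *\<^sub>v cvec \<nu> \<in> carrier_vec n" if "X \<in> carrier_mat n n" for X
    using that by (intro mult_mat_vec_carrier[of _ n n]) (use \<nu> in auto)
  have "(cmat T)\<^sup>T \<in> carrier_mat m n" using T by simp
  then show ?thesis
    unfolding h[OF C] h[OF H] pencil_mult_vec[OF C H map_carrier_vec[THEN iffD2, OF \<nu>]]
    using c[OF C] c[OF H]
    by (simp add: mult_add_distrib_mat_vec[of _ m n] mult_mat_vec[of _ m n])
qed


lemma real_vec_parts [simp]:
  "map_vec cnj (cvec v) = cvec v" "map_vec Re (cvec v) = v" "map_vec Im (cvec v) = 0\<^sub>v (dim_vec v)"
  by (auto intro: eq_vecI)

lemma pencil_blk_NN:
  assumes C: "C \<in> carrier_mat n n" "C\<^sup>T = C" and H: "H \<in> carrier_mat n n" "H\<^sup>T = H"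
    and \<nu>: "\<nu> \<in> carrier_vec n"
  shows "cvec \<nu> \<bullet> (pencil C H *\<^sub>v cvec \<nu>) = Complex (blk_NN \<nu> C) (blk_NN \<nu> H)"
proof -
  have "0\<^sub>v n \<bullet> (X *\<^sub>v 0\<^sub>v n) = (0 :: real)" if "X \<in> carrier_mat n n" for X
    using that by (intro scalar_prod_left_zero mult_mat_vec_carrier[of _ n n]) auto
  then show ?thesis
    using pencil_form[OF C H, of "cvec \<nu>"] C H \<nu> by (simp add: blk_NN_def)
qed

text \<open>The estimates come from testing the form of the pencil at one vector W with normal
  component 1. The determinant identity comes from a congruence in which the same W replaces the
  normal as last column on one side.\<close>

lemma schur_compl_properties:
  assumes T: "T \<in> carrier_mat n m" "T\<^sup>T * T = 1\<^sub>m m" "T\<^sup>T *\<^sub>v \<nu> = 0\<^sub>v m" and n: "n = Suc m"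
    and \<nu>: "\<nu> \<in> carrier_vec n" "\<nu> \<bullet> \<nu> = 1"
    and C: "C \<in> carrier_mat n n" "C\<^sup>T = C" "coercive C"
    and H: "H \<in> carrier_mat n n" "H\<^sup>T = H" "nonneg_form H"
  defines "D \<equiv> pencil (blk_TT T C) (blk_TT T H)"
    and "e \<equiv> cvec (blk_TN T \<nu> C) + \<i> \<cdot>\<^sub>v cvec (blk_TN T \<nu> H)"
  shows "det D \<noteq> 0"
    and "det (pencil C H) = det D * schur_compl T \<nu> C H"
    and "1 \<le> Re (schur_compl T \<nu> C H)"
    and "0 \<le> Im (schur_compl T \<nu> C H)"
    and "cmod (e \<bullet> (the (mat_inverse D) *\<^sub>v e)) \<le> csq e"
proof -
  have CT: "blk_TT T C \<in> carrier_mat m m" "(blk_TT T C)\<^sup>T = blk_TT T C"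
    and HT: "blk_TT T H \<in> carrier_mat m m" "(blk_TT T H)\<^sup>T = blk_TT T H"
    using T C H by (simp_all add: blk_TT_symmetric)
  have coT: "coercive (blk_TT T C)" using blk_TT_coercive[OF T(1,2) C(1,3)] .
  have Dcar: "D \<in> carrier_mat m m" unfolding D_def using CT HT by simp
  have e: "e \<in> carrier_vec m" unfolding e_def using T by simp
  show detD: "det D \<noteq> 0" unfolding D_def by (rule det_pencil_nonzero[OF CT HT coT])
  define Di where "Di = the (mat_inverse D)"
  have Di: "Di \<in> carrier_mat m m" "D * Di = 1\<^sub>m m"
    unfolding Di_def using the_mat_inverse[OF Dcar detD] by auto
  define x where "x = Di *\<^sub>v e"
  \<comment> \<open>The sign makes the tangential part D y + e of K (T y + \<nu>) vanish.\<close>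
  define y where "y = - x"
  have x: "x \<in> carrier_vec m" unfolding x_def using Di(1) e by (rule mult_mat_vec_carrier)
  then have y: "y \<in> carrier_vec m" by (simp add: y_def)
  have Dx: "D *\<^sub>v x = e"
    unfolding x_def using assoc_mult_mat_vec[OF Dcar Di(1) e] Di(2) e by simp
  then have Dy: "D *\<^sub>v y = - e" unfolding y_def Dx[symmetric] using Dcar x by (intro eq_vecI) auto
  have "csq x \<le> csq e"
    using csq_solution_le[OF CT HT x coT] Dx by (simp add: D_def)
  then show "cmod (e \<bullet> (the (mat_inverse D) *\<^sub>v e)) \<le> csq e"
    using cmod_scalar_prod_le[OF e x] by (simp add: x_def Di_def)

  define K where "K = pencil C H"
  define Tc where "Tc = cmat T"
  define \<nu>c where "\<nu>c = cvec \<nu>"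
  have K: "K \<in> carrier_mat n n" "K\<^sup>T = K"
    unfolding K_def using C H by (simp_all add: pencil_symmetric)
  have Tc: "Tc \<in> carrier_mat n m" and TcT: "Tc\<^sup>T \<in> carrier_mat m n" using T by (simp_all add: Tc_def)
  have \<nu>c: "\<nu>c \<in> carrier_vec n" using \<nu> by (simp add: \<nu>c_def)
  have Tc1: "Tc\<^sup>T * Tc = 1\<^sub>m m"
  proof -
    have "cmat (T\<^sup>T * T) = Tc\<^sup>T * Tc"
      using T(1) by (simp add: Tc_def map_mat_transpose of_real_hom.mat_hom_mult[of _ m n _ m])
    then show ?thesis by (simp add: T(2) of_real_hom.mat_hom_one)
  qed
  have Tc\<nu>: "Tc\<^sup>T *\<^sub>v \<nu>c = 0\<^sub>v m"
  proof -
    have "cvec (T\<^sup>T *\<^sub>v \<nu>) = Tc\<^sup>T *\<^sub>v \<nu>c"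
      using T(1) \<nu>(1)
      by (simp add: Tc_def \<nu>c_def map_mat_transpose of_real_hom.mult_mat_vec_hom[of _ m n])
    then show ?thesis by (simp add: T(3) of_real_hom.vec_hom_zero)
  qed
  have \<nu>\<nu>: "\<nu>c \<bullet> \<nu>c = 1"
  proof -
    have "\<nu>c \<bullet> \<nu>c = complex_of_real (\<nu> \<bullet> \<nu>)"
      using \<nu>(1) unfolding scalar_prod_sum[OF \<nu>(1)] scalar_prod_sum[OF \<nu>c] by (simp add: \<nu>c_def)
    then show ?thesis by (simp add: \<nu>(2))
  qed
  have Ty: "Tc *\<^sub>v y \<in> carrier_vec n" using Tc y by (rule mult_mat_vec_carrier)
  define W where "W = Tc *\<^sub>v y + \<nu>c"
  have W: "W \<in> carrier_vec n" using Ty \<nu>c by (simp add: W_def)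
  have KTy: "K *\<^sub>v (Tc *\<^sub>v y) \<in> carrier_vec n" and K\<nu>: "K *\<^sub>v \<nu>c \<in> carrier_vec n"
    and KW: "K *\<^sub>v W \<in> carrier_vec n"
    using K(1) Ty \<nu>c W by (auto intro: mult_mat_vec_carrier)
  have KW_eq: "K *\<^sub>v W = K *\<^sub>v (Tc *\<^sub>v y) + K *\<^sub>v \<nu>c"
    unfolding W_def by (rule mult_add_distrib_mat_vec[OF K(1) Ty \<nu>c])
  have TKT: "Tc\<^sup>T * (K * Tc) = D"
    unfolding Tc_def K_def D_def by (rule pencil_blk_TT[OF T(1) C(1) H(1)])
  have TK\<nu>: "Tc\<^sup>T *\<^sub>v (K *\<^sub>v \<nu>c) = e"
    unfolding Tc_def K_def e_def \<nu>c_def by (rule pencil_blk_TN[OF T(1) C(1) H(1) \<nu>(1)])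
  have "Tc\<^sup>T *\<^sub>v (K *\<^sub>v (Tc *\<^sub>v y)) = D *\<^sub>v y"
    using assoc_mult_mat_vec[OF TcT mult_carrier_mat[OF K(1) Tc] y] assoc_mult_mat_vec[OF K(1) Tc y]
    by (simp add: TKT)
  then have TKW: "Tc\<^sup>T *\<^sub>v (K *\<^sub>v W) = 0\<^sub>v m"
    unfolding KW_eq using mult_add_distrib_mat_vec[OF TcT KTy K\<nu>] e by (simp add: TK\<nu> Dy)
  \<comment> \<open>Bilinear symmetry of K moves it onto the normal, and the tangential part of K
    \<nu> is e.\<close>
  have "\<nu>c \<bullet> (K *\<^sub>v (Tc *\<^sub>v y)) = e \<bullet> y"
    using transpose_vec_mult_scalar[OF K(1) Ty \<nu>c] transpose_vec_mult_scalar[OF Tc y K\<nu>]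
    by (simp add: K(2) TK\<nu>)
  also have "\<dots> = - (e \<bullet> x)" unfolding y_def using e x by simp
  finally have \<nu>KW: "\<nu>c \<bullet> (K *\<^sub>v W) = schur_compl T \<nu> C H"
    unfolding KW_eq scalar_prod_add_distrib[OF \<nu>c KTy K\<nu>]
    using pencil_blk_NN[OF C(1,2) H(1,2) \<nu>(1)]
    by (simp add: schur_compl_def Let_def K_def \<nu>c_def x_def Di_def D_def e_def)

  \<comment> \<open>The frame and the normal are real, so conjugation only affects y. As K W is
    orthogonal to the frame, just the normal component contributes to the form.\<close>
  have "map_vec cnj W = Tc *\<^sub>v map_vec cnj y + \<nu>c"
    unfolding W_def using Tc y \<nu>c
    by (intro eq_vecI) (auto simp: scalar_prod_def Tc_def \<nu>c_def)
  moreover have "(Tc *\<^sub>v map_vec cnj y) \<bullet> (K *\<^sub>v W) = 0"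
    using transpose_vec_mult_scalar[OF TcT KW, of "map_vec cnj y"] y by (simp add: TKW)
  moreover have "Tc *\<^sub>v map_vec cnj y \<in> carrier_vec n"
    using Tc y by (intro mult_mat_vec_carrier[of _ n m]) auto
  ultimately have WKW: "map_vec cnj W \<bullet> (K *\<^sub>v W) = schur_compl T \<nu> C H"
    using KW \<nu>c by (simp add: add_scalar_prod_distrib[of _ n] \<nu>KW)
  have \<nu>W: "\<nu>c \<bullet> W = 1"
    unfolding W_def scalar_prod_add_distrib[OF \<nu>c Ty \<nu>c]
    using transpose_vec_mult_scalar[OF Tc y \<nu>c] y by (simp add: Tc\<nu> \<nu>\<nu>)
  have "csq \<nu>c = 1" using \<nu> by (simp add: \<nu>c_def csq_eq_Re_Im)
  \<comment> \<open>From 1 = |\<nu> . W| \<le> (1 + |W|^2) / 2.\<close>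
  then have "1 \<le> csq W" using cmod_scalar_prod_le[OF \<nu>c W] by (simp add: \<nu>W)
  also have "\<dots> \<le> Re (schur_compl T \<nu> C H)"
    using csq_le_pencil_form[OF C(1,2) H(1,2) W C(3)] by (simp add: WKW[unfolded K_def])
  finally show "1 \<le> Re (schur_compl T \<nu> C H)" .
  have "0 \<le> v \<bullet> (H *\<^sub>v v)" if "v \<in> carrier_vec n" for v
    using H that by (auto simp: nonneg_form_def)
  then have "0 \<le> Im (map_vec cnj W \<bullet> (K *\<^sub>v W))"
    unfolding K_def pencil_form[OF C(1,2) H(1,2) W] using W by simp
  then show "0 \<le> Im (schur_compl T \<nu> C H)" by (simp add: WKW)

  \<comment> \<open>Q borders the frame by the normal, V by W. Only the product of their
    determinants matters, and it is 1 because \<open>Q\<^sup>T * V\<close> is unipotent upper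
    triangular by blocks.\<close>
  define Q where "Q = snoc_col Tc \<nu>c"
  define V where "V = snoc_col Tc W"
  have Q: "Q \<in> carrier_mat n n" and V: "V \<in> carrier_mat n n"
    unfolding Q_def V_def n by (intro snoc_col_carrier, use Tc n in simp)+
  have c4: "\<nu>c \<bullet> (1\<^sub>m n *\<^sub>v col Tc j) = 0" if "j < m" for j
  proof -
    have "\<nu>c \<bullet> col Tc j = (Tc\<^sup>T *\<^sub>v \<nu>c) $ j"
      using Tc \<nu>c that comm_scalar_prod[of "col Tc j" n \<nu>c] by simp
    then show ?thesis using Tc that by (simp add: Tc\<nu>)
  qed
  have "Q\<^sup>T * (1\<^sub>m n * V) = four_block_mat (1\<^sub>m m) (Matrix.mat m 1 (\<lambda>(i, j). y $ i)) (0\<^sub>m 1 m) (1\<^sub>m 1)"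
  proof -
    have "Tc\<^sup>T *\<^sub>v (1\<^sub>m n *\<^sub>v W) = y"
    proof -
      have "Tc\<^sup>T *\<^sub>v (Tc *\<^sub>v y) = y" using assoc_mult_mat_vec[OF TcT Tc y] y by (simp add: Tc1)
      then show ?thesis
        using mult_add_distrib_mat_vec[OF TcT Ty \<nu>c] W y by (simp add: W_def Tc\<nu>)
    qed
    moreover have "Tc\<^sup>T * (1\<^sub>m n * Tc) = 1\<^sub>m m" using Tc by (simp add: Tc1)
    moreover have "Matrix.mat 1 m (\<lambda>(i, j). \<nu>c \<bullet> (1\<^sub>m n *\<^sub>v col Tc j)) = 0\<^sub>m 1 m"
      by (intro eq_matI) (auto simp: c4)
    moreover have "Matrix.mat 1 1 (\<lambda>_. \<nu>c \<bullet> (1\<^sub>m n *\<^sub>v W)) = 1\<^sub>m 1"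
      using W by (intro eq_matI) (auto simp: \<nu>W)
    ultimately show ?thesis
      unfolding Q_def V_def snoc_col_congruence[OF Tc one_carrier_mat \<nu>c W] by simp
  qed
  then have "det (Q\<^sup>T * V) = 1"
    using V by (simp add: det_four_block_mat_lower_left_zero[of _ m _ 1])
  then have QV: "det Q * det V = 1"
    using Q V by (simp add: det_mult[of _ n] det_transpose[OF Q])
  \<comment> \<open>The upper right block is the tangential part of K W, which is zero; the diagonal
    blocks are D and the Schur complement.\<close>
  have "Q\<^sup>T * (K * V) = four_block_mat D (0\<^sub>m m 1)
      (Matrix.mat 1 m (\<lambda>(i, j). \<nu>c \<bullet> (K *\<^sub>v col Tc j))) (Matrix.mat 1 1 (\<lambda>_. schur_compl T \<nu> C H))"
  proof -
    have "Matrix.mat m 1 (\<lambda>(i, j). (Tc\<^sup>T *\<^sub>v (K *\<^sub>v W)) $ i) = 0\<^sub>m m 1"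
      by (intro eq_matI) (auto simp: TKW)
    then show ?thesis
      unfolding Q_def V_def snoc_col_congruence[OF Tc K(1) \<nu>c W] by (simp add: TKT \<nu>KW)
  qed
  then have "det (Q\<^sup>T * (K * V)) = det D * schur_compl T \<nu> C H"
    using Dcar by (simp add: det_four_block_mat_upper_right_zero[of _ m _ 1] det_single)
  moreover have "det (Q\<^sup>T * (K * V)) = (det Q * det V) * det K"
    using Q V K by (simp add: det_mult[of _ n] det_transpose[OF Q])
  ultimately show "det (pencil C H) = det D * schur_compl T \<nu> C H"
    by (simp add: QV K_def)
qed

section \<open>Rank one perturbations of the identity\<close>

lemma outer_prod_carrier [simp]:
  "\<lbrakk>p \<in> carrier_vec n; q \<in> carrier_vec m\<rbrakk> \<Longrightarrow> outer_prod p q \<in> carrier_mat n m"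
  by (simp add: outer_prod_def)

lemma outer_prod_mult_vec:
  "\<lbrakk>q \<in> carrier_vec m; v \<in> carrier_vec m\<rbrakk> \<Longrightarrow> outer_prod p q *\<^sub>v v = (q \<bullet> v) \<cdot>\<^sub>v p"
  by (intro eq_vecI) (auto simp: outer_prod_def scalar_prod_def sum_distrib_left mult_ac)

lemma mat_mult_outer_prod:
  assumes "X \<in> carrier_mat k n" "p \<in> carrier_vec n" "q \<in> carrier_vec m"
  shows "X * outer_prod p q = outer_prod (X *\<^sub>v p) q"
  using assms by (intro eq_matI) (auto simp: outer_prod_def scalar_prod_def sum_distrib_left mult_ac)

lemma outer_prod_mult_mat:
  assumes "X \<in> carrier_mat m k" "p \<in> carrier_vec n" "q \<in> carrier_vec m"
  shows "outer_prod p q * X = outer_prod p (X\<^sup>T *\<^sub>v q)"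
  using assms by (intro eq_matI) (auto simp: outer_prod_def scalar_prod_def sum_distrib_left mult_ac)

lemma smult_mat_mult_vec:
  fixes X :: "'a :: comm_semiring_0 mat"
  assumes "X \<in> carrier_mat k n" "v \<in> carrier_vec n"
  shows "(c \<cdot>\<^sub>m X) *\<^sub>v v = c \<cdot>\<^sub>v (X *\<^sub>v v)"
  using assms by (intro eq_vecI) auto

text \<open>With the coefficient b free, this family is closed under multiplication for fixed q, so
  a square root can be sought inside it.\<close>

definition rank_one_pert :: "real \<Rightarrow> real vec \<Rightarrow> real mat" where
  "rank_one_pert b q = 1\<^sub>m (dim_vec q) + b \<cdot>\<^sub>m outer_prod q q"

lemma rank_one_pert_carrier [simp]:
  "q \<in> carrier_vec n \<Longrightarrow> rank_one_pert b q \<in> carrier_mat n n"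
  by (simp add: rank_one_pert_def outer_prod_def)

lemma rank_one_pert_mult_vec:
  assumes "q \<in> carrier_vec n" "v \<in> carrier_vec n"
  shows "rank_one_pert b q *\<^sub>v v = v + (b * (q \<bullet> v)) \<cdot>\<^sub>v q"
proof -
  have "(b \<cdot>\<^sub>m outer_prod q q) *\<^sub>v v = b \<cdot>\<^sub>v (outer_prod q q *\<^sub>v v)"
    using assms by (intro smult_mat_mult_vec[of _ n n]) auto
  then show ?thesis
    using assms
    by (simp add: rank_one_pert_def add_mult_distrib_mat_vec[of _ n n] outer_prod_mult_vec[of _ n]
        smult_smult_assoc)
qed

lemma rank_one_pert_form:
  assumes "q \<in> carrier_vec n" "v \<in> carrier_vec n" "u \<in> carrier_vec n"
  shows "u \<bullet> (rank_one_pert b q *\<^sub>v v) = u \<bullet> v + b * (q \<bullet> v) * (q \<bullet> u)"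
  using assms comm_scalar_prod[of u n q]
  by (simp add: rank_one_pert_mult_vec scalar_prod_add_distrib[of _ n])

lemma rank_one_pert_mult:
  assumes q: "q \<in> carrier_vec n"
  shows "rank_one_pert x q * rank_one_pert y q = rank_one_pert (x + y + x * y * (q \<bullet> q)) q"
proof -
  let ?E = "outer_prod q q"
  have E: "?E \<in> carrier_mat n n" using q by simp
  have "?E * ?E = (q \<bullet> q) \<cdot>\<^sub>m ?E"
    unfolding mat_mult_outer_prod[OF E q q] outer_prod_mult_vec[OF q q]
    by (intro eq_matI) (auto simp: outer_prod_def)
  moreover have "rank_one_pert x q * rank_one_pert y q =
      (1\<^sub>m n + y \<cdot>\<^sub>m ?E) + (x \<cdot>\<^sub>m ?E + (x * y) \<cdot>\<^sub>m (?E * ?E))"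
  proof -
    have "(x \<cdot>\<^sub>m ?E) * (1\<^sub>m n + y \<cdot>\<^sub>m ?E) = x \<cdot>\<^sub>m ?E + (x \<cdot>\<^sub>m ?E) * (y \<cdot>\<^sub>m ?E)"
      using E by (simp add: mult_add_distrib_mat[of _ n n _ n])
    also have "(x \<cdot>\<^sub>m ?E) * (y \<cdot>\<^sub>m ?E) = (x * y) \<cdot>\<^sub>m (?E * ?E)"
      using E by (intro eq_matI) (auto simp: mult_smult_distrib[of _ n n _ n] mult_smult_assoc_mat[of _ n n _ n] mult.assoc)
    finally show ?thesis
      using E q by (simp add: rank_one_pert_def add_mult_distrib_mat[of _ n n _ _ n]
          left_mult_one_mat[of "1\<^sub>m n + y \<cdot>\<^sub>m ?E" n n])
  qed
  ultimately show ?thesis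
    using q by (intro eq_matI) (auto simp: rank_one_pert_def outer_prod_def algebra_simps)
qed

lemma scalar_prod_Cauchy_Schwarz:
  assumes "u \<in> carrier_vec n" "v \<in> carrier_vec n"
  shows "(u \<bullet> v)\<^sup>2 \<le> (u \<bullet> u) * (v \<bullet> v :: real)"
  using Cauchy_Schwarz_ineq_sum[of "\<lambda>i. u $ i" "\<lambda>i. v $ i" "{..<n}"]
  by (simp add: scalar_prod_sum[OF assms(1)] scalar_prod_sum[OF assms(2)] power2_eq_square)

lemma scalar_prod_self_nonneg: "0 \<le> (v \<bullet> v :: real)"
  by (simp add: scalar_prod_def sum_nonneg)

lemma scalar_prod_self_pos:
  assumes "v \<in> carrier_vec n" "v \<noteq> 0\<^sub>v n"
  shows "0 < (v \<bullet> v :: real)"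
proof (rule ccontr)
  assume "\<not> 0 < v \<bullet> v"
  then have "v \<bullet> v = 0" using scalar_prod_self_nonneg[of v] by simp
  then have "v $ i = 0" if "i < n" for i
    using that assms(1) by (simp add: scalar_prod_sum sum_nonneg_eq_0_iff)
  then have "v = 0\<^sub>v n" using assms(1) by (intro eq_vecI) auto
  with assms(2) show False by simp
qed

text \<open>\<open>inv_sqrt_mat\<close> is a choice, so an explicit inverse square root is
  exhibited. The conclusions then follow from the chosen properties alone, without identifying the
  chosen matrix with the witness.\<close>

lemma inv_sqrt_mat_rank_one_pert:
  assumes a: "0 < a" and b: "0 \<le> b" and q: "q \<in> carrier_vec n"
  defines "G \<equiv> a \<cdot>\<^sub>m rank_one_pert b q"
  defines "B \<equiv> inv_sqrt_mat G"
  shows "B \<in> carrier_mat n n" "B\<^sup>T = B" "det B \<noteq> 0" "B * G * B = 1\<^sub>m n"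
proof -
  have G: "G \<in> carrier_mat n n" using q by (simp add: G_def)
  define N where "N = q \<bullet> q"
  define r where "r = sqrt (1 + b * N)"
  \<comment> \<open>Chosen so that the factor 1 - \<kappa> N along q is 1 / r; this form has no
    division by N and so covers q = 0.\<close>
  define \<kappa> where "\<kappa> = b / (r * (1 + r))"
  define B0 where "B0 = (1 / sqrt a) \<cdot>\<^sub>m rank_one_pert (- \<kappa>) q"
  have N: "0 \<le> N" by (simp add: N_def scalar_prod_self_nonneg)
  have r: "0 < r" "r\<^sup>2 = 1 + b * N" using b N by (simp_all add: r_def add_pos_nonneg)
  have B0: "B0 \<in> carrier_mat n n" using q by (simp add: B0_def)
  have \<kappa>N: "1 - \<kappa> * N = 1 / r"
  proof -
    have "\<kappa> * N = (r\<^sup>2 - 1) / (r * (1 + r))" using r(2) by (simp add: \<kappa>_def)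
    also have "r\<^sup>2 - 1 = (r - 1) * (1 + r)" by (simp add: algebra_simps power2_eq_square)
    also have "\<dots> / (r * (1 + r)) = (r - 1) / r" using r(1) by simp
    finally show ?thesis using r(1) by (simp add: field_simps)
  qed
  have \<kappa>: "0 \<le> \<kappa>" using b r by (simp add: \<kappa>_def)
  have pos: "0 < v \<bullet> (B0 *\<^sub>v v)" if v: "v \<in> carrier_vec n" "v \<noteq> 0\<^sub>v n" for v
  proof -
    have "0 < (1 - \<kappa> * N) * (v \<bullet> v)"
      using scalar_prod_self_pos[OF v] r(1) by (simp add: \<kappa>N)
    \<comment> \<open>Cauchy-Schwarz: the direction of q is the worst case for positivity.\<close>
    also have "\<dots> \<le> v \<bullet> v - \<kappa> * (q \<bullet> v)\<^sup>2"
      using mult_left_mono[OF scalar_prod_Cauchy_Schwarz[OF q v(1)] \<kappa>] by (simp add: N_def algebra_simps)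
    also have "\<dots> = v \<bullet> (rank_one_pert (- \<kappa>) q *\<^sub>v v)"
      by (simp add: rank_one_pert_form[OF q v(1) v(1)] power2_eq_square mult.assoc)
    finally have "0 < (1 / sqrt a) * (v \<bullet> (rank_one_pert (- \<kappa>) q *\<^sub>v v))" using a by simp
    moreover have "B0 *\<^sub>v v = (1 / sqrt a) \<cdot>\<^sub>v (rank_one_pert (- \<kappa>) q *\<^sub>v v)"
      unfolding B0_def using q v(1) by (intro smult_mat_mult_vec[of _ n n]) auto
    ultimately show ?thesis using q v(1)
      by (simp add: scalar_prod_smult_distrib[of _ n] mult_mat_vec_carrier[of _ n n])
  qed
  have "sym_posdef B0"
    unfolding sym_posdef_def
  proof (intro conjI ballI impI)
    show "B0\<^sup>T = B0"
      unfolding B0_def by (intro eq_matI) (auto simp: rank_one_pert_def outer_prod_def)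
  qed (use B0 pos in auto)
  moreover have "B0 * B0 * G = 1\<^sub>m n"
  proof -
    let ?P = "rank_one_pert (- \<kappa>) q" and ?R = "rank_one_pert b q"
    have PR: "?P \<in> carrier_mat n n" "?R \<in> carrier_mat n n" using q by simp_all
    \<comment> \<open>The coefficient of the square of \<open>?P\<close>. That square is inverse to
      \<open>?R\<close> once x (1 + b N) = - b.\<close>
    define x where "x = - \<kappa> + - \<kappa> + - \<kappa> * - \<kappa> * N"
    have "x = - \<kappa> * (1 + (1 - \<kappa> * N))" by (simp add: x_def algebra_simps)
    also have "\<dots> * r\<^sup>2 = - (\<kappa> * (r * (1 + r)))"
      unfolding \<kappa>N using r(1) by (simp add: algebra_simps power2_eq_square)
    also have "\<dots> = - b" using r(1) by (simp add: \<kappa>_def)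
    finally have "x * r\<^sup>2 = - b" .
    then have x0: "x + b + x * b * N = 0" unfolding r(2) by (simp add: algebra_simps)
    have "?P * ?P * ?R = rank_one_pert (x + b + x * b * N) q"
      by (simp add: rank_one_pert_mult[OF q] x_def N_def)
    also have "\<dots> = 1\<^sub>m n"
      unfolding x0 using q by (intro eq_matI) (auto simp: rank_one_pert_def outer_prod_def)
    finally have PPR: "?P * (?P * ?R) = 1\<^sub>m n" using PR by simp
    have "B0 * B0 * G = a \<cdot>\<^sub>m ((1 / sqrt a) \<cdot>\<^sub>m ((1 / sqrt a) \<cdot>\<^sub>m (?P * (?P * ?R))))"
      unfolding B0_def G_def using PR
      by (simp add: mult_smult_distrib[of _ n n _ n] mult_smult_assoc_mat[of _ n n _ n])
    also have "\<dots> = 1\<^sub>m n" unfolding PPR using a by (intro eq_matI) auto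
    finally show ?thesis .
  qed
  moreover have "dim_row G = n" using G by simp
  ultimately have "B \<in> carrier_mat (dim_row G) (dim_row G) \<and> sym_posdef B \<and> (B * B) * G = 1\<^sub>m (dim_row G)"
    unfolding B_def inv_sqrt_mat_def using B0
    by (intro someI[of "\<lambda>B. B \<in> carrier_mat (dim_row G) (dim_row G) \<and> sym_posdef B \<and>
      (B * B) * G = 1\<^sub>m (dim_row G)" B0]) (simp only: simp_thms)
  then have B: "B \<in> carrier_mat n n" "sym_posdef B" "B * B * G = 1\<^sub>m n" using G by auto
  then have BBG: "B * (B * G) = 1\<^sub>m n" using G by simp
  have BG: "B * G \<in> carrier_mat n n" using B G by simp
  show "B \<in> carrier_mat n n" "B\<^sup>T = B" using B by (auto simp: sym_posdef_def)
  \<comment> \<open>B is a left inverse of B G, hence also a right inverse.\<close>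
  show "B * G * B = 1\<^sub>m n" by (rule mat_mult_left_right_inverse[OF B(1) BG BBG])
  have "det B * det (B * G) = 1" using det_mult[OF B(1) BG] BBG by simp
  then show "det B \<noteq> 0" by auto
qed

lemma C_mat_eq: "C_mat t p = w_fun t p \<cdot>\<^sub>m rank_one_pert (t\<^sup>2) p"
  by (simp add: C_mat_def metric_mat_def rank_one_pert_def)

text \<open>Congruence by R turns C + i s M into k (1 + i s X) with X = R M R / k, at the cost of
  the positive factor (det R)^2. The constant c does not depend on s. The parameter k serves two
  normalizations: for \<open>A_mat\<close> the weight w remains outside the square root, for the
  tangential block it is inside.\<close>

lemma det_pencil_eq_prod:
  assumes R: "R \<in> carrier_mat n n" "R\<^sup>T = R" "det R \<noteq> 0"
    and C: "C \<in> carrier_mat n n" and k: "0 < k" and RCR: "R * C * R = k \<cdot>\<^sub>m 1\<^sub>m n"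
    and M: "M \<in> carrier_mat n n" "M\<^sup>T = M"
  obtains as c where "0 < c" "phase ((1 / k) \<cdot>\<^sub>m (R * M * R)) = (\<Sum>a\<leftarrow>as. arctan a)"
    "\<And>s. det (pencil C (s \<cdot>\<^sub>m M)) = of_real c * (\<Prod>a\<leftarrow>as. 1 + \<i> * complex_of_real (s * a))"
proof -
  define X where "X = (1 / k) \<cdot>\<^sub>m (R * M * R)"
  have X: "X \<in> carrier_mat n n" using R M by (simp add: X_def)
  have "(R * M * R)\<^sup>T = R * M * R"
    using R M by (simp add: transpose_mult[of _ n n _ n] assoc_mult_mat[of _ n n _ n _ n])
  moreover have "X\<^sup>T = (1 / k) \<cdot>\<^sub>m (R * M * R)\<^sup>T" unfolding X_def by (intro eq_matI) auto
  ultimately have "X\<^sup>T = X" by (simp add: X_def)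
  then obtain as where as: "length as = n" "char_poly X = (\<Prod>a\<leftarrow>as. [:- a, 1:])"
    using real_symmetric_char_poly_splits[OF X] by blast
  interpret h: map_poly_inj_idom_hom complex_of_real ..
  have "map_poly complex_of_real (\<Prod>a\<leftarrow>as. [:- a, 1:]) = (\<Prod>a\<leftarrow>map complex_of_real as. [:- a, 1:])"
    by (induction as) (simp_all add: hom_distribs)
  then have cX: "char_poly (cmat X) = (\<Prod>a\<leftarrow>map complex_of_real as. [:- a, 1:])"
    by (simp only: of_real_hom.char_poly_hom[OF X] as(2))
  have det1: "det (1\<^sub>m n + c \<cdot>\<^sub>m cmat X) = (\<Prod>a\<leftarrow>as. 1 + c * complex_of_real a)" for c
    using det_one_add_smult[of "cmat X" n "map complex_of_real as" c] X as(1) cX by (simp add: o_def)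
  have Rc: "cmat R \<in> carrier_mat n n" using R by simp
  define d where "d = det R"
  have "det (pencil C (s \<cdot>\<^sub>m M)) = of_real (k ^ n / d\<^sup>2) *
      (\<Prod>a\<leftarrow>as. 1 + \<i> * complex_of_real (s * a))" for s
  proof -
    let ?K = "pencil C (s \<cdot>\<^sub>m M)"
    have K: "?K \<in> carrier_mat n n" using C M by simp
    have conj: "cmat R * cmat Y * cmat R = cmat (R * Y * R)" if "Y \<in> carrier_mat n n" for Y
      using R(1) that by (simp add: of_real_hom.mat_hom_mult[of _ n n _ n])
    have "R * (s \<cdot>\<^sub>m M) * R = s \<cdot>\<^sub>m (R * M * R)"
      using R M by (simp add: mult_smult_distrib[of _ n n _ n] mult_smult_assoc_mat[of _ n n _ n])
    then have RMR: "R * (s \<cdot>\<^sub>m M) * R = (k * s) \<cdot>\<^sub>m X"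
      unfolding X_def using k by (intro eq_matI) auto
    have "cmat R * ?K * cmat R = cmat R * cmat C * cmat R + \<i> \<cdot>\<^sub>m (cmat R * cmat (s \<cdot>\<^sub>m M) * cmat R)"
      using R C M by (simp add: mult_add_distrib_mat[of _ n n _ n] add_mult_distrib_mat[of _ n n _ _ n]
          mult_smult_distrib[of _ n n _ n] mult_smult_assoc_mat[of _ n n _ n] del: assoc_mult_mat)
    also have "\<dots> = of_real k \<cdot>\<^sub>m (1\<^sub>m n + (\<i> * of_real s) \<cdot>\<^sub>m cmat X)"
      using M C X by (simp add: conj RCR RMR del: assoc_mult_mat) (intro eq_matI, auto simp: algebra_simps)
    finally have "det (cmat R * ?K * cmat R) = of_real k ^ n * det (1\<^sub>m n + (\<i> * of_real s) \<cdot>\<^sub>m cmat X)"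
      using X by simp
    moreover have "det (cmat R * ?K * cmat R) = (of_real d)\<^sup>2 * det ?K"
      using det_mult[OF mult_carrier_mat[OF Rc K] Rc] det_mult[OF Rc K]
      by (simp add: d_def power2_eq_square)
    ultimately have "(of_real d)\<^sup>2 * det ?K = of_real k ^ n * (\<Prod>a\<leftarrow>as. 1 + \<i> * complex_of_real (s * a))"
      by (simp add: det1 mult.assoc)
    then show ?thesis using R(3) by (simp add: d_def field_simps)
  qed
  moreover have "0 < k ^ n / d\<^sup>2" using k R(3) by (simp add: d_def)
  moreover have "phase X = (\<Sum>a\<leftarrow>as. arctan a)" by (rule phase_eq_sum_list[OF as(2)])
  ultimately show ?thesis using that by (simp add: X_def)
qed

section \<open>The boundary phase identity\<close>

lemma w_fun_ge_1: "1 \<le> w_fun t p"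
  by (simp add: w_fun_def)

lemma vnorm_sq: "(vnorm v)\<^sup>2 = v \<bullet> v"
  by (simp add: vnorm_def scalar_prod_self_nonneg)

lemma C_mat_carrier: "p \<in> carrier_vec n \<Longrightarrow> C_mat t p \<in> carrier_mat n n"
  by (simp add: C_mat_eq)

lemma C_mat_symmetric: "(C_mat t p)\<^sup>T = C_mat t p"
  unfolding C_mat_eq by (intro eq_matI) (auto simp: rank_one_pert_def outer_prod_def)

lemma C_mat_mult_vec:
  assumes "p \<in> carrier_vec n" "v \<in> carrier_vec n"
  shows "C_mat t p *\<^sub>v v = w_fun t p \<cdot>\<^sub>v (rank_one_pert (t\<^sup>2) p *\<^sub>v v)"
  unfolding C_mat_eq using assms by (intro smult_mat_mult_vec[of _ n n]) auto

lemma C_mat_form: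
  assumes p: "p \<in> carrier_vec n" and v: "v \<in> carrier_vec n"
  shows "v \<bullet> (C_mat t p *\<^sub>v v) = w_fun t p * (v \<bullet> v + t\<^sup>2 * (p \<bullet> v)\<^sup>2)"
  using assms
  by (simp add: C_mat_mult_vec scalar_prod_smult_distrib[of _ n] mult_mat_vec_carrier[of _ n n]
      rank_one_pert_form[of _ n] power2_eq_square mult.assoc)

lemma C_mat_coercive:
  assumes p: "p \<in> carrier_vec n"
  shows "coercive (C_mat t p)"
  unfolding coercive_def
proof
  fix v :: "real vec" assume "v \<in> carrier_vec (dim_row (C_mat t p))"
  then have v: "v \<in> carrier_vec n" using C_mat_carrier[OF p, of t] by simp
  have "1 * (v \<bullet> v) \<le> w_fun t p * (v \<bullet> v + t\<^sup>2 * (p \<bullet> v)\<^sup>2)"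
    using scalar_prod_self_nonneg[of v] w_fun_ge_1[of t p] by (intro mult_mono) auto
  then show "v \<bullet> v \<le> v \<bullet> (C_mat t p *\<^sub>v v)" by (simp add: C_mat_form[OF p v])
qed

text \<open>The orthonormal frame compresses the identity to the identity and p to q =
  \<open>T\<^sup>T *\<^sub>v p\<close>. The tangential block is again a scaled rank one
  perturbation, so its inverse square root is under control too.\<close>

lemma blk_TT_C_mat:
  assumes T: "T \<in> carrier_mat n m" "T\<^sup>T * T = 1\<^sub>m m" and p: "p \<in> carrier_vec n"
  shows "blk_TT T (C_mat t p) = w_fun t p \<cdot>\<^sub>m rank_one_pert (t\<^sup>2) (T\<^sup>T *\<^sub>v p)"
proof -
  let ?E = "outer_prod p p" and ?q = "T\<^sup>T *\<^sub>v p"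
  have E: "?E \<in> carrier_mat n n" and q: "?q \<in> carrier_vec m" and Tt: "T\<^sup>T \<in> carrier_mat m n"
    using p T(1) by (auto intro: mult_mat_vec_carrier)
  have "T\<^sup>T * (?E * T) = outer_prod ?q ?q"
    unfolding outer_prod_mult_mat[OF T(1) p p] by (rule mat_mult_outer_prod[OF Tt p q])
  moreover have "rank_one_pert (t\<^sup>2) p * T = T + t\<^sup>2 \<cdot>\<^sub>m (?E * T)"
    using p T(1) E by (simp add: rank_one_pert_def add_mult_distrib_mat[of _ n n _ _ m]
        mult_smult_assoc_mat[of _ n n _ m])
  moreover have "T\<^sup>T * (T + t\<^sup>2 \<cdot>\<^sub>m (?E * T)) = T\<^sup>T * T + t\<^sup>2 \<cdot>\<^sub>m (T\<^sup>T * (?E * T))"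
  proof -
    have ET: "?E * T \<in> carrier_mat n m" using E T(1) by (rule mult_carrier_mat)
    then show ?thesis
      by (subst mult_add_distrib_mat[OF Tt T(1)]) (simp_all add: mult_smult_distrib[OF Tt ET])
  qed
  ultimately have "T\<^sup>T * (rank_one_pert (t\<^sup>2) p * T) = rank_one_pert (t\<^sup>2) ?q"
    using T(1) by (simp add: T(2) rank_one_pert_def)
  moreover have "rank_one_pert (t\<^sup>2) p * T \<in> carrier_mat n m"
    by (rule mult_carrier_mat[OF rank_one_pert_carrier[OF p] T(1)])
  ultimately show ?thesis
    unfolding blk_TT_def C_mat_eq using p T(1) Tt
    by (simp add: mult_smult_distrib[of _ m n _ m] mult_smult_assoc_mat[of _ n n _ m]
        assoc_mult_mat[of _ m n _ n _ m])
qed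

text \<open>The identity part of the metric drops out because the frame is orthogonal to \<nu>; what
  remains is w t^2 s q with s = p . \<nu>.\<close>

lemma blk_TN_C_mat:
  assumes T: "T \<in> carrier_mat n m" "T\<^sup>T *\<^sub>v \<nu> = 0\<^sub>v m"
    and p: "p \<in> carrier_vec n" and \<nu>: "\<nu> \<in> carrier_vec n"
  shows "blk_TN T \<nu> (C_mat t p) = (w_fun t p * (t\<^sup>2 * (p \<bullet> \<nu>))) \<cdot>\<^sub>v (T\<^sup>T *\<^sub>v p)"
proof -
  have Tt: "T\<^sup>T \<in> carrier_mat m n" using T by simp
  have "T\<^sup>T *\<^sub>v (\<nu> + (t\<^sup>2 * (p \<bullet> \<nu>)) \<cdot>\<^sub>v p) = (t\<^sup>2 * (p \<bullet> \<nu>)) \<cdot>\<^sub>v (T\<^sup>T *\<^sub>v p)"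
    using p \<nu> Tt by (simp add: mult_add_distrib_mat_vec[of _ m n] mult_mat_vec[of _ m n] T(2)
        left_zero_vec[of _ m] mult_mat_vec_carrier[of _ m n])
  then show ?thesis
    unfolding blk_TN_def C_mat_mult_vec[OF p \<nu>] rank_one_pert_mult_vec[OF p \<nu>]
    using p \<nu> Tt by (simp add: mult_mat_vec[of _ m n] smult_smult_assoc)
qed

text \<open>Bessel's inequality, from expanding the squared norm of p minus its tangential
  projection.\<close>

lemma frame_projection_le:
  assumes T: "T \<in> carrier_mat n m" "T\<^sup>T * T = 1\<^sub>m m" and p: "p \<in> carrier_vec n"
  shows "(T\<^sup>T *\<^sub>v p) \<bullet> (T\<^sup>T *\<^sub>v p) \<le> (p \<bullet> p :: real)"
proof -
  let ?q = "T\<^sup>T *\<^sub>v p"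
  have q: "?q \<in> carrier_vec m" using T p by (auto intro: mult_mat_vec_carrier)
  then have Tq: "T *\<^sub>v ?q \<in> carrier_vec n" using T by (auto intro: mult_mat_vec_carrier)
  have 1: "p \<bullet> (T *\<^sub>v ?q) = ?q \<bullet> ?q"
    using transpose_vec_mult_scalar[OF T(1) q p] by simp
  have 2: "(T *\<^sub>v ?q) \<bullet> (T *\<^sub>v ?q) = ?q \<bullet> ?q" by (rule frame_isometry[OF T q])
  have "0 \<le> (p - T *\<^sub>v ?q) \<bullet> (p - T *\<^sub>v ?q)" by (rule scalar_prod_self_nonneg)
  also have "\<dots> = p \<bullet> p - p \<bullet> (T *\<^sub>v ?q) - ((T *\<^sub>v ?q) \<bullet> p - (T *\<^sub>v ?q) \<bullet> (T *\<^sub>v ?q))"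
    using p Tq by (simp add: minus_scalar_prod_distrib[of _ n] scalar_prod_minus_distrib[of _ n])
  also have "\<dots> = p \<bullet> p - ?q \<bullet> ?q"
    unfolding comm_scalar_prod[OF Tq p] 1 2 by simp
  finally show ?thesis by simp
qed

text \<open>Both determinants are factored along the same path s H. Their quotient is the Schur
  complement, so the difference of the two sums of arctangents is its argument at s = 1.\<close>

lemma boundary_phase_identity:
  fixes t :: real
  assumes T: "T \<in> carrier_mat n m" "T\<^sup>T * T = 1\<^sub>m m" "T\<^sup>T *\<^sub>v \<nu> = 0\<^sub>v m" and n: "n = Suc m"
    and \<nu>: "\<nu> \<in> carrier_vec n" "\<nu> \<bullet> \<nu> = 1" and p: "p \<in> carrier_vec n"
    and H: "H \<in> carrier_mat n n" "H\<^sup>T = H" "nonneg_form H"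
  defines "\<sigma> \<equiv> schur_compl T \<nu> (C_mat t p) H"
  shows "delta_bd T t p H = pi / 2 - arctan (Im \<sigma> / Re \<sigma>)"
proof -
  define C where "C = C_mat t p"
  define w where "w = w_fun t p"
  have w: "0 < w" using w_fun_ge_1[of t p] by (simp add: w_def)
  have C: "C \<in> carrier_mat n n" "C\<^sup>T = C" "coercive C"
    unfolding C_def by (simp_all add: C_mat_carrier[OF p] C_mat_symmetric C_mat_coercive[OF p])
  have one_smult: "1 \<cdot>\<^sub>m X = X" for X :: "real mat" by (intro eq_matI) auto

  define B where "B = B_mat t p"
  have B_eq: "B = inv_sqrt_mat (1 \<cdot>\<^sub>m rank_one_pert (t\<^sup>2) p)"
    by (simp add: B_def B_mat_def metric_mat_def rank_one_pert_def one_smult)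
  have B: "B \<in> carrier_mat n n" "B\<^sup>T = B" "det B \<noteq> 0" "B * rank_one_pert (t\<^sup>2) p * B = 1\<^sub>m n"
    using inv_sqrt_mat_rank_one_pert[of 1 "t\<^sup>2" p n] p by (simp_all add: B_eq one_smult)
  have "B * C * B = w \<cdot>\<^sub>m (B * rank_one_pert (t\<^sup>2) p * B)"
    unfolding C_def C_mat_eq w_def using B(1) p
    by (simp add: mult_smult_distrib[of _ n n _ n] mult_smult_assoc_mat[of _ n n _ n])
  then have BCB: "B * C * B = w \<cdot>\<^sub>m 1\<^sub>m n" by (simp only: B(4))
  obtain as c1 where 1: "0 < c1" "phase ((1 / w) \<cdot>\<^sub>m (B * H * B)) = (\<Sum>a\<leftarrow>as. arctan a)"
    "\<And>s. det (pencil C (s \<cdot>\<^sub>m H)) = of_real c1 * (\<Prod>a\<leftarrow>as. 1 + \<i> * complex_of_real (s * a))"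
    using det_pencil_eq_prod[OF B(1-3) C(1) w BCB H(1,2)] by blast

  define R where "R = inv_sqrt_mat (blk_TT T C)"
  have q: "T\<^sup>T *\<^sub>v p \<in> carrier_vec m" using T p by (auto intro: mult_mat_vec_carrier)
  have CT: "blk_TT T C = w \<cdot>\<^sub>m rank_one_pert (t\<^sup>2) (T\<^sup>T *\<^sub>v p)"
    unfolding C_def w_def by (rule blk_TT_C_mat[OF T(1,2) p])
  have R: "R \<in> carrier_mat m m" "R\<^sup>T = R" "det R \<noteq> 0" "R * blk_TT T C * R = 1 \<cdot>\<^sub>m 1\<^sub>m m"
    using inv_sqrt_mat_rank_one_pert[OF w _ q, of "t\<^sup>2"] by (simp_all add: R_def CT one_smult)
  obtain bs c2 where 2: "0 < c2" "phase ((1 / 1) \<cdot>\<^sub>m (R * blk_TT T H * R)) = (\<Sum>a\<leftarrow>bs. arctan a)"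
    "\<And>s. det (pencil (blk_TT T C) (s \<cdot>\<^sub>m blk_TT T H)) =
       of_real c2 * (\<Prod>a\<leftarrow>bs. 1 + \<i> * complex_of_real (s * a))"
  proof -
    have one: "(0 :: real) < 1" by simp
    note d = det_pencil_eq_prod[OF R(1-3) blk_TT_carrier[OF T(1) C(1)] one R(4)]
    show ?thesis by (rule d[OF blk_TT_carrier[OF T(1) H(1)] blk_TT_symmetric[OF T(1) H(1,2)] that])
  qed

  have sH: "s \<cdot>\<^sub>m H \<in> carrier_mat n n" "(s \<cdot>\<^sub>m H)\<^sup>T = s \<cdot>\<^sub>m H" for s
  proof -
    have "(s \<cdot>\<^sub>m H)\<^sup>T = s \<cdot>\<^sub>m H\<^sup>T" by (intro eq_matI) auto
    then show "(s \<cdot>\<^sub>m H)\<^sup>T = s \<cdot>\<^sub>m H" by (simp add: H(2))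
  qed (use H in simp)
  \<comment> \<open>Convexity survives along the whole path, which keeps the Schur complement in the
    right half plane.\<close>
  have sH_nonneg: "nonneg_form (s \<cdot>\<^sub>m H)" if "0 \<le> s" for s
    using H that
    by (auto simp: nonneg_form_def smult_mat_mult_vec[of _ n n] scalar_prod_smult_distrib[of _ n]
        mult_mat_vec_carrier[of _ n n])
  have TsH: "blk_TT T (s \<cdot>\<^sub>m H) = s \<cdot>\<^sub>m blk_TT T H" for s
    unfolding blk_TT_def using T H
    by (simp add: mult_smult_distrib[of _ m n _ n] mult_smult_distrib[of _ m n _ m]
        mult_smult_assoc_mat[of _ m n _ m] mult_smult_assoc_mat[of _ n n _ m])
  note sc = schur_compl_properties[OF T n \<nu> C sH sH_nonneg]
  have "(\<Sum>a\<leftarrow>as. arctan a) - (\<Sum>b\<leftarrow>bs. arctan b) =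
      arctan (Im (schur_compl T \<nu> C (1 \<cdot>\<^sub>m H)) / Re (schur_compl T \<nu> C (1 \<cdot>\<^sub>m H)))"
  \<comment> \<open>The quotient of the positive constants of the two factorizations, the same for
    every s.\<close>
  proof (rule sum_arctan_diff_eq_arctan[where k = "c2 / c1"])
    fix s :: real assume s: "0 \<le> s"
    show "0 < Re (schur_compl T \<nu> C (s \<cdot>\<^sub>m H))" using sc(3)[OF s] by linarith
    have "of_real c1 * (\<Prod>a\<leftarrow>as. 1 + \<i> * complex_of_real (s * a)) =
        of_real c2 * (\<Prod>b\<leftarrow>bs. 1 + \<i> * complex_of_real (s * b)) * schur_compl T \<nu> C (s \<cdot>\<^sub>m H)"
      using sc(2)[OF s] by (simp only: 1(3) TsH 2(3))
    then show "(\<Prod>a\<leftarrow>as. 1 + \<i> * complex_of_real (s * a)) = of_real (c2 / c1) *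
        schur_compl T \<nu> C (s \<cdot>\<^sub>m H) * (\<Prod>b\<leftarrow>bs. 1 + \<i> * complex_of_real (s * b))"
      using 1(1) by (simp add: field_simps)
  qed (use 1 2 in simp)
  moreover have "phase (A_mat t p H) = (\<Sum>a\<leftarrow>as. arctan a)"
    using 1(2) by (simp add: A_mat_def B_def w_def)
  moreover have "L_bd T t p H = pi / 2 + (\<Sum>b\<leftarrow>bs. arctan b)"
    using 2(2) by (simp add: L_bd_def Let_def R_def C_def one_smult)
  ultimately show ?thesis
    unfolding delta_bd_def \<sigma>_def by (simp add: one_smult C_def)
qed

text \<open>For b > 0 the arctangents of b / a and a / b are complementary; at b = 0 the value
  \<open>pi / 2\<close> set in \<open>arctan_quot\<close> agrees with this.\<close>

lemma arctan_quot_complement: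
  assumes "0 < a" "0 \<le> b"
  shows "pi / 2 - arctan (b / a) = arctan_quot a b"
proof (cases "b = 0")
  case False
  then have "b / a > 0" using assms by simp
  then have "arctan (1 / (b / a)) = pi / 2 - arctan (b / a)"
    using arctan_inverse[of "b / a"] False assms by (simp add: sgn_if)
  then show ?thesis using False by (simp add: arctan_quot_def)
qed (simp add: arctan_quot_def)

lemma mult_cot_arctan_quot:
  assumes "0 < a" "0 \<le> b"
  shows "a * cot (arctan_quot a b) = b"
  using assms by (simp add: arctan_quot_def cot_altdef tan_arctan)

text \<open>Both blocks are explicit in w, t, s and q, and |s| and |q| are at most |p|, while t
  \<le> 1 removes t from the bounds.\<close>

lemma coupling_bound:
  assumes T: "T \<in> carrier_mat n m" "T\<^sup>T * T = 1\<^sub>m m" "T\<^sup>T *\<^sub>v \<nu> = 0\<^sub>v m"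
    and \<nu>: "\<nu> \<in> carrier_vec n" "\<nu> \<bullet> \<nu> = 1" and p: "p \<in> carrier_vec n"
    and t: "0 \<le> t" "t \<le> 1" and P: "vnorm p \<le> P"
  shows "0 \<le> blk_NN \<nu> (C_mat t p)" "blk_NN \<nu> (C_mat t p) \<le> (1 + P\<^sup>2) * (1 + P\<^sup>2)"
    and "blk_TN T \<nu> (C_mat t p) \<bullet> blk_TN T \<nu> (C_mat t p) \<le> (1 + P\<^sup>2) * (P\<^sup>2 * P\<^sup>2)"
proof -
  let ?w = "w_fun t p" and ?q = "T\<^sup>T *\<^sub>v p" and ?s = "p \<bullet> \<nu>"
  have t2: "0 \<le> t\<^sup>2" "t\<^sup>2 \<le> 1" using t by (simp_all add: power_le_one)
  have t4: "t ^ 4 \<le> 1" using t by (simp add: power_le_one)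
  have "0 \<le> vnorm p" by (simp add: vnorm_def scalar_prod_self_nonneg)
  then have p2: "0 \<le> p \<bullet> p" "p \<bullet> p \<le> P\<^sup>2"
    using P power_mono[of "vnorm p" P 2] by (simp_all add: vnorm_sq scalar_prod_self_nonneg)
  have s2: "?s\<^sup>2 \<le> P\<^sup>2" using scalar_prod_Cauchy_Schwarz[OF p \<nu>(1)] p2 by (simp add: \<nu>(2))
  have "?w\<^sup>2 = 1 + t\<^sup>2 * (p \<bullet> p)" using t2 p2 by (simp add: w_fun_def vnorm_sq)
  also have "\<dots> \<le> 1 + 1 * P\<^sup>2" using t2 p2 by (intro add_left_mono mult_mono) auto
  finally have w2: "?w\<^sup>2 \<le> 1 + P\<^sup>2" by simp
  \<comment> \<open>As w is at least 1 it is bounded by its square, which keeps roots out of the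
    constant.\<close>
  have "?w * 1 \<le> ?w * ?w" using w_fun_ge_1[of t p] by (intro mult_left_mono) auto
  then have w1: "?w \<le> 1 + P\<^sup>2" using w2 by (simp add: power2_eq_square)
  have w0: "0 \<le> ?w" using w_fun_ge_1[of t p] by simp
  have NN: "blk_NN \<nu> (C_mat t p) = ?w * (1 + t\<^sup>2 * ?s\<^sup>2)"
    by (simp add: blk_NN_def C_mat_form[OF p \<nu>(1)] \<nu>(2))
  show "0 \<le> blk_NN \<nu> (C_mat t p)" unfolding NN using w0 by simp
  have "t\<^sup>2 * ?s\<^sup>2 \<le> 1 * P\<^sup>2" using t2 s2 by (intro mult_mono) auto
  then show "blk_NN \<nu> (C_mat t p) \<le> (1 + P\<^sup>2) * (1 + P\<^sup>2)"
    unfolding NN using w0 w1 by (intro mult_mono) auto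
  have q: "?q \<in> carrier_vec m" using T p by (auto intro: mult_mat_vec_carrier)
  have qq: "?q \<bullet> ?q \<le> P\<^sup>2" using frame_projection_le[OF T(1,2) p] p2 by linarith
  have "blk_TN T \<nu> (C_mat t p) \<bullet> blk_TN T \<nu> (C_mat t p) = ?w\<^sup>2 * ((t\<^sup>2)\<^sup>2 * (?s\<^sup>2 * (?q \<bullet> ?q)))"
    unfolding blk_TN_C_mat[OF T(1,3) p \<nu>(1)] using q
    by (simp add: power2_eq_square mult_ac)
  also have "\<dots> \<le> (1 + P\<^sup>2) * (1 * (P\<^sup>2 * P\<^sup>2))"
    using w2 t2 t4 s2 qq scalar_prod_self_nonneg[of ?q]
    by (intro mult_mono) (auto simp: power_le_one)
  finally show "blk_TN T \<nu> (C_mat t p) \<bullet> blk_TN T \<nu> (C_mat t p) \<le> (1 + P\<^sup>2) * (P\<^sup>2 * P\<^sup>2)"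
    by simp
qed

lemma inward_unit_normal_unit:
  assumes "inward_unit_normal n \<Omega> x \<nu>"
  shows "\<nu> \<in> carrier_vec n" "\<nu> \<bullet> \<nu> = 1"
proof -
  obtain \<rho> where \<rho>: "grad n \<rho> x \<noteq> 0\<^sub>v n" "\<nu> = (1 / vnorm (grad n \<rho> x)) \<cdot>\<^sub>v grad n \<rho> x"
    using assms by (auto simp: inward_unit_normal_def local_defining_function_def)
  have g: "grad n \<rho> x \<in> carrier_vec n" by (simp add: grad_def)
  then show "\<nu> \<in> carrier_vec n" by (simp add: \<rho>(2))
  have "vnorm (grad n \<rho> x) \<noteq> 0"
    using scalar_prod_self_pos[OF g \<rho>(1)] by (auto simp flip: vnorm_sq)
  moreover have "\<nu> \<bullet> \<nu> = (1 / vnorm (grad n \<rho> x))\<^sup>2 * (grad n \<rho> x \<bullet> grad n \<rho> x)"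
    unfolding \<rho>(2) using g by (simp add: power2_eq_square)
  ultimately show "\<nu> \<bullet> \<nu> = 1"
    by (simp add: power_divide flip: vnorm_sq)
qed

text \<open>The function C is quantified before n, the domain, u, t, the point and the frame, which
  expresses dependence on P and Z only.\<close>

theorem theorem1p5:
  shows "\<exists>C :: real \<Rightarrow> real \<Rightarrow> real.
    \<forall>n \<ge> 2. \<forall>\<Omega> u t x \<nu> T.
      bounded_smooth_domain n \<Omega> \<longrightarrow>
      C2_up_to_boundary n \<Omega> u \<longrightarrow>
      (\<forall>y \<in> Euclidean_space n closure_of \<Omega>. nonneg_form (D2u n \<Omega> u y)) \<longrightarrow>
      0 \<le> t \<longrightarrow> t \<le> 1 \<longrightarrow>
      x \<in> Euclidean_space n frontier_of \<Omega> \<longrightarrow>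
      inward_unit_normal n \<Omega> x \<nu> \<longrightarrow>
      tangent_frame n \<nu> T \<longrightarrow>
      (let p = Du n \<Omega> u x; H = D2u n \<Omega> u x;
           z = blk_TN T \<nu> H; r = blk_NN \<nu> H;
           \<alpha> = alpha_bd T \<nu> t p H; \<beta> = beta_bd T \<nu> t p H; \<delta> = delta_bd T t p H
       in \<delta> = arctan_quot \<alpha> (r - \<beta>) \<and> 0 < \<alpha> \<and> 0 \<le> r - \<beta> \<and>
          (\<forall>P Z. vnorm p \<le> P \<longrightarrow> vnorm z \<le> Z \<longrightarrow>
             r = \<beta> + \<alpha> * cot \<delta> \<and> 1 \<le> \<alpha> \<and> \<alpha> \<le> C P Z \<and> \<bar>\<beta>\<bar> \<le> C P Z))"
\<comment> \<open>The first summand bounds the normal entry of C_t. The other two bound the squared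
  norms of the real and imaginary parts of e, and hence |S|.\<close>
proof (rule exI[of _ "\<lambda>P Z. (1 + P\<^sup>2) * (1 + P\<^sup>2) + (1 + P\<^sup>2) * (P\<^sup>2 * P\<^sup>2) + Z\<^sup>2"], intro allI impI)
  fix n :: nat and \<Omega> u and t :: real and x \<nu> T
  assume n2: "2 \<le> n" and \<Omega>: "bounded_smooth_domain n \<Omega>" and u: "C2_up_to_boundary n \<Omega> u"
    and conv: "\<forall>y \<in> Euclidean_space n closure_of \<Omega>. nonneg_form (D2u n \<Omega> u y)"
    and t: "0 \<le> t" "t \<le> 1" and x: "x \<in> Euclidean_space n frontier_of \<Omega>"
    and nu: "inward_unit_normal n \<Omega> x \<nu>" and frame: "tangent_frame n \<nu> T"
  define m where "m = n - 1"
  have n: "n = Suc m" using n2 by (simp add: m_def)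
  have T: "T \<in> carrier_mat n m" "T\<^sup>T * T = 1\<^sub>m m" "T\<^sup>T *\<^sub>v \<nu> = 0\<^sub>v m"
    using frame by (auto simp: tangent_frame_def m_def)
  note \<nu> = inward_unit_normal_unit[OF nu]
  define p where "p = Du n \<Omega> u x"
  define H where "H = D2u n \<Omega> u x"
  have p: "p \<in> carrier_vec n" by (simp add: p_def Du_def)
  have H: "H \<in> carrier_mat n n" by (simp add: H_def D2u_def)
  have Hs: "H\<^sup>T = H"
    using \<Omega> u unfolding H_def bounded_smooth_domain_def C2_up_to_boundary_def
    by (intro D2u_symmetric) auto
  have Hn: "nonneg_form H"
    using conv x unfolding H_def frontier_of_def by blast
  define z where "z = blk_TN T \<nu> H"
  define r where "r = blk_NN \<nu> H"
  define \<alpha> where "\<alpha> = alpha_bd T \<nu> t p H"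
  define \<beta> where "\<beta> = beta_bd T \<nu> t p H"
  define \<delta> where "\<delta> = delta_bd T t p H"
  define e where "e = e_bd T \<nu> t p H"
  define S where "S = S_bd T \<nu> t p H"
  define c where "c = blk_TN T \<nu> (C_mat t p)"
  note sc = schur_compl_properties[OF T n \<nu> C_mat_carrier[OF p] C_mat_symmetric C_mat_coercive[OF p]
      H Hs Hn]
  have \<sigma>: "schur_compl T \<nu> (C_mat t p) H = Complex \<alpha> (r - \<beta>)"
    by (simp add: schur_compl_def \<alpha>_def \<beta>_def alpha_bd_def beta_bd_def S_bd_def r_def Let_def
        e_bd_def D_bd_def complex_eq_iff)
  have \<alpha>: "1 \<le> \<alpha>" and r\<beta>: "0 \<le> r - \<beta>" using sc(3,4)[of t] by (simp_all add: \<sigma>)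
  have \<delta>: "\<delta> = arctan_quot \<alpha> (r - \<beta>)"
    using boundary_phase_identity[OF T n \<nu> p H Hs Hn, of t] arctan_quot_complement[of \<alpha> "r - \<beta>"] \<alpha> r\<beta>
    by (simp add: \<delta>_def \<sigma>)
  have bounds: "r = \<beta> + \<alpha> * cot \<delta> \<and> 1 \<le> \<alpha> \<and>
      \<alpha> \<le> (1 + P\<^sup>2) * (1 + P\<^sup>2) + (1 + P\<^sup>2) * (P\<^sup>2 * P\<^sup>2) + Z\<^sup>2 \<and>
      \<bar>\<beta>\<bar> \<le> (1 + P\<^sup>2) * (1 + P\<^sup>2) + (1 + P\<^sup>2) * (P\<^sup>2 * P\<^sup>2) + Z\<^sup>2"
    if P: "vnorm p \<le> P" and Z: "vnorm z \<le> Z" for P Z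
  proof -
    have "0 \<le> vnorm z" by (simp add: vnorm_def scalar_prod_self_nonneg)
    then have zz: "z \<bullet> z \<le> Z\<^sup>2" using Z power_mono[of "vnorm z" Z 2] by (simp add: vnorm_sq)
    note cb = coupling_bound[OF T \<nu> p t P]
    have cz: "c \<in> carrier_vec m" "z \<in> carrier_vec m" using T by (simp_all add: c_def z_def)
    \<comment> \<open>The real part of e is controlled by P and the imaginary part by Z, so |e|^2
      splits accordingly.\<close>
    have "map_vec Re e = c" "map_vec Im e = z"
      unfolding e_def e_bd_def c_def[symmetric] z_def[symmetric] using cz by (auto intro!: eq_vecI)
    then have "csq e = c \<bullet> c + z \<bullet> z" by (simp add: csq_eq_Re_Im)
    moreover have "cmod S \<le> csq e"
      using sc(5)[of t] by (simp add: S_def S_bd_def e_def e_bd_def D_bd_def)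
    ultimately have "cmod S \<le> (1 + P\<^sup>2) * (P\<^sup>2 * P\<^sup>2) + Z\<^sup>2"
      using cb(3) zz by (simp add: c_def)
    moreover have "\<bar>Re S\<bar> \<le> cmod S" "\<bar>Im S\<bar> \<le> cmod S"
      by (rule abs_Re_le_cmod, rule abs_Im_le_cmod)
    moreover have "\<alpha> = blk_NN \<nu> (C_mat t p) - Re S" "\<beta> = Im S"
      by (simp_all add: \<alpha>_def \<beta>_def S_def alpha_bd_def beta_bd_def)
    moreover have "r = \<beta> + \<alpha> * cot \<delta>"
      using mult_cot_arctan_quot[of \<alpha> "r - \<beta>"] \<alpha> r\<beta> by (simp add: \<delta>)
    ultimately show ?thesis using \<alpha> cb(1,2) by (auto simp: abs_le_iff)
  qed
  show "let p = Du n \<Omega> u x; H = D2u n \<Omega> u x;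
           z = blk_TN T \<nu> H; r = blk_NN \<nu> H;
           \<alpha> = alpha_bd T \<nu> t p H; \<beta> = beta_bd T \<nu> t p H; \<delta> = delta_bd T t p H
       in \<delta> = arctan_quot \<alpha> (r - \<beta>) \<and> 0 < \<alpha> \<and> 0 \<le> r - \<beta> \<and>
          (\<forall>P Z. vnorm p \<le> P \<longrightarrow> vnorm z \<le> Z \<longrightarrow>
             r = \<beta> + \<alpha> * cot \<delta> \<and> 1 \<le> \<alpha> \<and>
             \<alpha> \<le> (1 + P\<^sup>2) * (1 + P\<^sup>2) + (1 + P\<^sup>2) * (P\<^sup>2 * P\<^sup>2) + Z\<^sup>2 \<and>
             \<bar>\<beta>\<bar> \<le> (1 + P\<^sup>2) * (1 + P\<^sup>2) + (1 + P\<^sup>2) * (P\<^sup>2 * P\<^sup>2) + Z\<^sup>2)"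
    using \<delta> \<alpha> r\<beta> bounds
    unfolding Let_def p_def[symmetric] H_def[symmetric] z_def[symmetric] r_def[symmetric]
      \<alpha>_def[symmetric] \<beta>_def[symmetric] \<delta>_def[symmetric]
    by auto
qed

end
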